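(* Let $m \geq 2$ and $N \geq 2$. Then \[\lim_{d \rightarrow \infty} \dfrac{\#\{f \in \mathcal{F}_{d,4}^{(1, N, N+1)}(\mathbb{F}_{q}) : \#C^{(m)}_{f}(\mathbb{F}_{q}) = k\}}{\#\mathcal{F}_{d,4}^{(1, N, N+1)}(\mathbb{F}_{q})} = \mathrm{Prob}\left(\sum_{i=1}^{q}X_{i} = k\right),\] where $X_{1}, \dots, X_{q}$ are i.i.d. random variables with $X_{i} = 0$ with probability $\left(1 - \frac{1}{(m, q-1)}\right)\frac{1}{1 + q^{-1} + q^{-N} + q^{-(N+1)}}$, $X_{i} = 1$ with probability $\frac{q^{-1} + q^{-N} + q^{-(N+1)}}{1 + q^{-1} + q^{-N} + q^{-(N+1)}}$, $X_{i} = (m, q-1)$ with probability $\frac{1}{(m, q-1)}\frac{1}{1 + q^{-1} + q^{-N} + q^{-(N+1)}}$, with the convention that when $(m, q-1) = 1$ the sum of the last two probabilities is $\mathrm{Prob}(X_{i} = 1)$. Moreover, if $\mathcal{F}_{d,4}^{(1, N, N+1)}(\mathbb{F}_{q})$ is replaced by $\hat{\mathcal{F}}_{d,4}^{(1, N, N+1)}(\mathbb{F}_{q})$, the same distribution is obtained.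
   Context: $\mathbb{F}_{q}$ is a fixed finite field. For $m \geq 2$ and $f \in \mathbb{F}_{q}[x]$, $C^{(m)}_{f}$ denotes the affine curve $y^{m} = f(x)$, and $\#C^{(m)}_{f}(\mathbb{F}_{q})$ is its number of $\mathbb{F}_{q}$-points in $\mathbb{A}^{2}$. Every $n$-th power-free polynomial $f \in \mathbb{F}_{q}[x]$ has a unique decomposition $f = a f_{1} f_{2}^{2} \cdots f_{n-1}^{n-1}$ with $a \in \mathbb{F}_{q}^{\times}$ and $f_{1},\dots,f_{n-1}$ monic and pairwise coprime. For a weight $\boldsymbol{c} = (c_{1}, \dots, c_{n-1})$ of positive integers, the weighted degree is $\deg(f, \boldsymbol{c}) = c_{1}\deg(f_{1}) + \cdots + c_{n-1}\deg(f_{n-1})$. $\hat{\mathcal{F}}_{d,n}^{\boldsymbol{c}}(\mathbb{F}_{q})$ is the set of $n$-th power-free $f \in \mathbb{F}_{q}[x]$ with $\deg(f, \boldsymbol{c}) = d$, and $\mathcal{F}_{d,n}^{\boldsymbol{c}}(\mathbb{F}_{q})$ is its subset of monic polynomials. $(m, q-1)$ denotes $\gcd(m, q-1)$. *)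

theory Defs
  imports
    "HOL-Probability.Probability"
    "HOL-Computational_Algebra.Polynomial_Factorial"
    "HOL-Computational_Algebra.Squarefree"
begin

text \<open>The zero polynomial is not power-free, since every \<open>g ^ n\<close> divides it.\<close>

definition power_free :: "nat \<Rightarrow> 'a::field poly \<Rightarrow> bool" where
  "power_free n f \<longleftrightarrow> (\<forall>g. g ^ n dvd f \<longrightarrow> g dvd 1)"

text \<open>
  \<open>f = a f\<^sub>1 f\<^sub>2\<^sup>2 \<dots>\<close> with exponents up to \<open>n - 1\<close>. The list is indexed from 0, so \<open>fs ! i\<close>
  is \<open>f\<close> with subscript \<open>i + 1\<close> and carries the exponent \<open>i + 1\<close>; weights are indexed the same way.
  The components have to be squarefree: without this the decomposition is not unique
  (for \<open>n = 4\<close>, \<open>x\<^sup>2\<close> could be read as \<open>f\<^sub>1 = x\<^sup>2\<close> or as \<open>f\<^sub>2 = x\<close>).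
\<close>

definition power_free_decomp ::
  "nat \<Rightarrow> 'a::field poly \<Rightarrow> 'a \<Rightarrow> 'a poly list \<Rightarrow> bool" where
  "power_free_decomp n f a fs \<longleftrightarrow>
     a \<noteq> 0 \<and> length fs = n - 1 \<and>
     (\<forall>i<n - 1. lead_coeff (fs ! i) = 1 \<and> squarefree (fs ! i)) \<and>
     (\<forall>i<n - 1. \<forall>j<n - 1. i \<noteq> j \<longrightarrow> coprime (fs ! i) (fs ! j)) \<and>
     f = smult a (\<Prod>i<n - 1. (fs ! i) ^ (i + 1))"

definition weighted_degree :: "nat \<Rightarrow> nat list \<Rightarrow> 'a::field poly \<Rightarrow> nat" where
  "weighted_degree n c f =
     (THE d. \<exists>a fs. power_free_decomp n f a fs \<and> d = (\<Sum>i<n - 1. c ! i * degree (fs ! i)))"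

definition F_hat :: "nat \<Rightarrow> nat \<Rightarrow> nat list \<Rightarrow> 'a::field poly set" where
  "F_hat d n c = {f. power_free n f \<and> weighted_degree n c f = d}"

definition F_monic :: "nat \<Rightarrow> nat \<Rightarrow> nat list \<Rightarrow> 'a::field poly set" where
  "F_monic d n c = {f \<in> F_hat d n c. lead_coeff f = 1}"

definition curve_points :: "nat \<Rightarrow> 'a::field poly \<Rightarrow> ('a \<times> 'a) set" where
  "curve_points m f = {(x, y). y ^ m = poly f x}"

text \<open>
  The probability that \<open>X\<^sub>i = v\<close>. The three cases are added up, so that for \<open>gcd m (q - 1) = 1\<close>
  the value 1 receives the sum of the last two probabilities.
\<close>

definition fibre_law :: "nat \<Rightarrow> nat \<Rightarrow> nat \<Rightarrow> nat \<Rightarrow> real" where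
  "fibre_law q m N v =
     (let g = gcd m (q - 1);
          w = 1 / real q + 1 / real q ^ N + 1 / real q ^ (N + 1)
      in (if v = 0 then (1 - 1 / real g) * (1 / (1 + w)) else 0)
       + (if v = 1 then w / (1 + w) else 0)
       + (if v = g then (1 / real g) * (1 / (1 + w)) else 0))"

end

(*
Writing f = f1 f2^2 f3^3 as s d^2 with s = f1 f3 and d = f2 f3 turns the family into the pairs of
arbitrary monic squarefree polynomials with deg s + N deg d = n: coprimality disappears. Splitting
off the roots in the field from s and d leaves squarefree polynomials without roots. The number
u_n(a) of those of degree n with values a satisfies, by sorting all polynomials with values a
according to their largest square divisor, q^(n-q) = sum over monic root-free e of
u_(n - 2 deg e)(a / e^2). After division by q^n the terms with e different from 1 have total
weight at most 1/2, so u_n(a) / q^n converges, to a limit that does not depend on a. Summing over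
d (Tannery's theorem) and over the possible zero sets of s and d, the number of f with values a is
asymptotic to K q^n ((q-1)(1/q + 1/q^N + 1/q^(N+1)))^z where z is the number of zeros of a. This is a
product over the points of the line, and the number of points of the curve is a sum over them.
*)
theory Submission
  imports Defs
begin

text \<open>Why root-free factors: sorting by square divisors divides the value function by
  \<open>e^2\<close>, which needs nonzero values, and without linear factors the first nontrivial
  \<open>e\<close> has degree 2. The sorting also changes the value function, so convergence is
  proved for all nonvanishing functions at once, through their largest deviation from the expected
  limit. Origin of the base of the power: a zero of \<open>s d^2\<close> is a zero of
  \<open>s\<close> only, of \<open>d\<close> only or of both, which costs degree 1, N or N + 1, and
  the remaining factor may take any of q - 1 nonzero values there. K is never evaluated: it is the
  same for all value functions and cancels in the ratio. The gcd enters because a nonempty fibre of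
  the m-th power map over a nonzero value is a coset of the m-th roots of unity. A leading
  coefficient rescales the values without moving zeros, so both families share one limit.\<close>

subsection \<open>Squarefree polynomials over a field\<close>

lemma prime_divisor_exists_poly:
  fixes p :: "'a::field poly"
  assumes "p \<noteq> 0" "\<not> p dvd 1"
  shows "\<exists>r. prime_elem r \<and> r dvd p"
  using assms
proof (induction "degree p" arbitrary: p rule: less_induct)
  case less
  show ?case
  proof (cases "irreducible p")
    case True
    then have "prime_elem p" by (rule field_poly_irreducible_imp_prime)
    then show ?thesis by (intro exI[of _ p]) simp
  next
    case False
    then obtain a b where ab: "p = a * b" "\<not> a dvd 1" "\<not> b dvd 1"
      using less.prems unfolding irreducible_def by metis
    have nz: "a \<noteq> 0" "b \<noteq> 0" using ab(1) less.prems(1) by auto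
    have "degree b > 0" using ab(3) nz by (simp add: is_unit_iff_degree)
    then have "degree a < degree p" using nz by (simp add: ab(1) degree_mult_eq)
    from less.hyps[OF this nz(1) ab(2)] obtain r where "prime_elem r" "r dvd a" by blast
    then show ?thesis by (intro exI[of _ r]) (simp add: ab(1))
  qed
qed

lemma squarefree_poly_iff:
  fixes p :: "'a::field poly"
  assumes "p \<noteq> 0"
  shows "squarefree p \<longleftrightarrow> (\<forall>r. prime_elem r \<longrightarrow> \<not> r\<^sup>2 dvd p)"
proof
  assume "squarefree p"
  then show "\<forall>r. prime_elem r \<longrightarrow> \<not> r\<^sup>2 dvd p"
    by (auto simp: squarefree_def prime_elem_def)
next
  assume *: "\<forall>r. prime_elem r \<longrightarrow> \<not> r\<^sup>2 dvd p"
  show "squarefree p"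
  proof (rule squarefreeI, rule ccontr)
    fix x assume x: "x\<^sup>2 dvd p" "\<not> x dvd 1"
    then have "x \<noteq> 0" using assms by auto
    then obtain r where "prime_elem r" "r dvd x"
      using prime_divisor_exists_poly x by blast
    then show False using * x(1) dvd_power_same dvd_trans by blast
  qed
qed

lemma squarefree_mult_coprime_poly:
  fixes p r :: "'a::field poly"
  assumes "squarefree p" "squarefree r" "coprime p r"
  shows "squarefree (p * r)"
proof -
  have nz: "p \<noteq> 0" "r \<noteq> 0" using assms by auto
  show ?thesis
  proof (subst squarefree_poly_iff, use nz in simp, intro allI impI notI)
    fix s assume s: "prime_elem s" "s\<^sup>2 dvd p * r"
    from s(2,1) have "\<exists>a b. a + b = 2 \<and> s ^ a dvd p \<and> s ^ b dvd r"
      by (rule prime_elem_power_dvd_prod)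
    then obtain a b where ab: "a + b = 2" "s ^ a dvd p" "s ^ b dvd r" by blast
    consider "a = 2" | "b = 2" | "a = 1" "b = 1" using ab(1) by linarith
    then show False
    proof cases
      case 1 then show False using ab s nz assms by (simp add: squarefree_poly_iff)
    next
      case 2 then show False using ab s nz assms by (simp add: squarefree_poly_iff)
    next
      case 3
      then have "s dvd 1" using ab assms(3) by (simp add: coprime_def)
      then show False using s by (simp add: prime_elem_def)
    qed
  qed
qed

lemma monic_scale:
  fixes p :: "'a::field poly"
  assumes "p \<noteq> 0"
  obtains c r where "c \<noteq> 0" "lead_coeff r = 1" "p = smult c r"
proof
  show "lead_coeff p \<noteq> 0" using assms by simp
  show "lead_coeff (smult (inverse (lead_coeff p)) p) = 1" using assms by simp
  show "p = smult (lead_coeff p) (smult (inverse (lead_coeff p)) p)" using assms by simp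
qed

text \<open>A polynomial that is not squarefree has a nonconstant square divisor; stripping it
  lowers the degree. The divisor is rescaled to be monic at each stage, since \<open>d\<close> is
  unique only up to a unit.\<close>

lemma squarefree_square_decomposition_exists:
  fixes p :: "'a::field poly"
  assumes "lead_coeff p = 1"
  shows "\<exists>s d. lead_coeff s = 1 \<and> squarefree s \<and> lead_coeff d = 1 \<and> p = s * d\<^sup>2"
  using assms
proof (induction "degree p" arbitrary: p rule: less_induct)
  case less
  show ?case
  proof (cases "squarefree p")
    case True
    then show ?thesis using less.prems by (intro exI[of _ p] exI[of _ 1]) auto
  next
    case False
    then obtain x where x: "x\<^sup>2 dvd p" "\<not> x dvd 1" by (auto simp: squarefree_def)
    have "p \<noteq> 0" using less.prems by auto
    with x(1) have "x \<noteq> 0" by auto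
    then obtain c y where y: "c \<noteq> 0" "lead_coeff y = 1" "x = smult c y" by (rule monic_scale)
    from x(1) y(1,3) have "y\<^sup>2 dvd p" by (auto simp: smult_power smult_dvd_iff)
    then obtain z where z: "p = y\<^sup>2 * z" by blast
    have lz: "lead_coeff z = 1" using less.prems y(2) unfolding z by (simp add: lead_coeff_mult lead_coeff_power)
    have nz: "y \<noteq> 0" "z \<noteq> 0" using lz y by auto
    have "degree y > 0" using x(2) y nz by (auto simp: is_unit_iff_degree \<open>x \<noteq> 0\<close>)
    then have "degree z < degree p" using nz unfolding z by (simp add: degree_mult_eq degree_power_eq)
    from less.hyps[OF this lz] obtain s d where
      sd: "lead_coeff s = 1" "squarefree s" "lead_coeff d = 1" "z = s * d\<^sup>2" by blast
    then show ?thesis using y(2) z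
      by (intro exI[of _ s] exI[of _ "y * d"]) (auto simp: lead_coeff_mult power_mult_distrib)
  qed
qed

text \<open>This is one half of uniqueness. The square of a prime \<open>r\<close> dividing
  \<open>d\<close> cannot be absorbed by the squarefree \<open>s'\<close>, so \<open>r\<close>
  divides \<open>d'\<close>; cancelling \<open>r^2\<close> on both sides lowers the degree of
  \<open>d\<close>.\<close>

lemma squarefree_square_decomposition_dvd:
  fixes s s' d d' :: "'a::field poly"
  assumes "squarefree s'" "d \<noteq> 0" "d' \<noteq> 0" "d\<^sup>2 dvd s' * d'\<^sup>2"
  shows "d dvd d'"
  using assms
proof (induction "degree d" arbitrary: d d' rule: less_induct)
  case less
  show ?case
  proof (cases "d dvd 1")
    case True then show ?thesis using dvd_trans one_dvd by blast
  next
    case False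
    then obtain r where r: "prime_elem r" "r dvd d"
      using prime_divisor_exists_poly less.prems by blast
    have "r\<^sup>2 dvd s' * d'\<^sup>2" using r(2) less.prems(4) dvd_power_same dvd_trans by blast
    then have "\<exists>a b. a + b = 2 \<and> r ^ a dvd s' \<and> r ^ b dvd d'\<^sup>2"
      using r(1) by (rule prime_elem_power_dvd_prod)
    then obtain a b where ab: "a + b = 2" "r ^ a dvd s'" "r ^ b dvd d'\<^sup>2" by blast
    have "a \<noteq> 2" using ab(2) r(1) less.prems(1)
      by (metis prime_elem_not_unit squarefreeD)
    then have "b > 0" using ab(1) by simp
    then have "r dvd d'\<^sup>2" using ab(3) dvd_trans dvd_power by blast
    then have "r dvd d'" using r(1) prime_elem_dvd_power by blast
    then obtain e e' where e: "d = r * e" "d' = r * e'" using r(2) by (meson dvdE)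
    have nz: "e \<noteq> 0" "e' \<noteq> 0" "r \<noteq> 0" using e less.prems by auto
    have "degree r > 0" using r nz by (auto simp: prime_elem_def is_unit_iff_degree)
    then have deg: "degree e < degree d" using e nz by (simp add: degree_mult_eq)
    have "r\<^sup>2 * e\<^sup>2 dvd r\<^sup>2 * (s' * e'\<^sup>2)"
      using less.prems(4) unfolding e by (simp add: power_mult_distrib algebra_simps)
    then have "e\<^sup>2 dvd s' * e'\<^sup>2" using nz(3) by (simp add: dvd_times_left_cancel_iff)
    then have "e dvd e'" using less.hyps[OF deg less.prems(1) nz(1,2)] by blast
    then show ?thesis unfolding e by simp
  qed
qed

lemma monic_dvd_antisym:
  fixes p r :: "'a::field poly"
  assumes "lead_coeff p = 1" "lead_coeff r = 1" "p dvd r" "r dvd p"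
  shows "p = r"
proof -
  obtain k where k: "r = p * k" using assms(3) by blast
  have nz: "p \<noteq> 0" "r \<noteq> 0" using assms by auto
  have "degree r \<le> degree p" using assms(4) nz by (simp add: dvd_imp_degree_le)
  moreover have "k \<noteq> 0" using k nz by auto
  ultimately have "degree k = 0" using k nz by (simp add: degree_mult_eq)
  moreover have "lead_coeff k = 1" using k assms by (simp add: lead_coeff_mult)
  ultimately have "k = 1" by (metis degree_0_id one_pCons)
  then show ?thesis using k by simp
qed

lemma squarefree_square_decomposition_unique:
  fixes s s' d d' :: "'a::field poly"
  assumes "squarefree s" "squarefree s'" "lead_coeff d = 1" "lead_coeff d' = 1"
    and "s * d\<^sup>2 = s' * d'\<^sup>2"
  shows "s = s'" "d = d'"
proof -
  have nz: "d \<noteq> 0" "d' \<noteq> 0" using assms by auto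
  have "d dvd d'" using squarefree_square_decomposition_dvd[of s' d d'] assms nz by (metis dvd_triv_right)
  moreover have "d' dvd d" using squarefree_square_decomposition_dvd[of s d' d] assms nz by (metis dvd_triv_right)
  ultimately show "d = d'" using monic_dvd_antisym assms by blast
  then show "s = s'" using assms(5) nz by simp
qed

text \<open>If a prime \<open>r\<close> had \<open>r^4\<close> dividing \<open>s * d^2\<close>, at
  most one factor \<open>r\<close> could come from \<open>s\<close>. Then \<open>r^3\<close> divides
  \<open>d * d\<close>, and one of the two copies of \<open>d\<close> receives
  \<open>r^2\<close>.\<close>

lemma power_free_4_iff:
  fixes s d :: "'a::field poly"
  assumes "squarefree s" "d \<noteq> 0" "c \<noteq> 0"
  shows "power_free 4 (smult c (s * d\<^sup>2)) \<longleftrightarrow> squarefree d"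
proof
  assume *: "power_free 4 (smult c (s * d\<^sup>2))"
  show "squarefree d"
  proof (rule squarefreeI)
    fix x assume "x\<^sup>2 dvd d"
    then have "(x\<^sup>2)\<^sup>2 dvd d\<^sup>2" by (rule dvd_power_same)
    then have "x ^ 4 dvd d\<^sup>2" by (simp add: power_mult[symmetric])
    then have "x ^ 4 dvd smult c (s * d\<^sup>2)" using assms(3) by (simp add: dvd_smult)
    then show "x dvd 1" using * by (simp add: power_free_def)
  qed
next
  assume d: "squarefree d"
  have snz: "s \<noteq> 0" using assms by auto
  show "power_free 4 (smult c (s * d\<^sup>2))"
    unfolding power_free_def
  proof (intro allI impI, rule ccontr)
    fix x assume x: "x ^ 4 dvd smult c (s * d\<^sup>2)" "\<not> x dvd 1"
    have x4: "x ^ 4 dvd s * d\<^sup>2" using x(1) assms(3) by (simp add: dvd_smult_iff)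
    have "x \<noteq> 0" using x4 snz assms(2) by auto
    then obtain r where r: "prime_elem r" "r dvd x"
      using prime_divisor_exists_poly x(2) by blast
    have "r ^ 4 dvd s * d\<^sup>2" using r(2) x4 dvd_power_same dvd_trans by blast
    then have "\<exists>a b. a + b = 4 \<and> r ^ a dvd s \<and> r ^ b dvd d\<^sup>2"
      using r(1) by (rule prime_elem_power_dvd_prod)
    then obtain a b where ab: "a + b = 4" "r ^ a dvd s" "r ^ b dvd d\<^sup>2" by blast
    have "\<not> r\<^sup>2 dvd s" "\<not> r\<^sup>2 dvd d" using r(1) assms d snz by (auto simp: squarefree_poly_iff)
    have "a < 2"
    proof (rule ccontr)
      assume "\<not> a < 2" then have "r\<^sup>2 dvd r ^ a" by (simp add: le_imp_power_dvd)
      then show False using ab(2) \<open>\<not> r\<^sup>2 dvd s\<close> dvd_trans by blast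
    qed
    then have "3 \<le> b" using ab by simp
    then have "r ^ 3 dvd d * d" using ab(3) le_imp_power_dvd dvd_trans by (metis power2_eq_square)
    then have "\<exists>a b. a + b = 3 \<and> r ^ a dvd d \<and> r ^ b dvd d"
      using r(1) by (rule prime_elem_power_dvd_prod)
    then obtain a b where ab: "a + b = 3" "r ^ a dvd d" "r ^ b dvd d" by blast
    then have "2 \<le> a \<or> 2 \<le> b" by linarith
    then show False using ab \<open>\<not> r\<^sup>2 dvd d\<close> le_imp_power_dvd dvd_trans by metis
  qed
qed

section \<open>The components f1, f2, f3 and the pair s, d\<close>

lemma smult_left_cancel_field:
  fixes p r :: "'a::field poly"
  assumes "c \<noteq> 0" "smult c p = smult c r"
  shows "p = r"
  using arg_cong[OF assms(2), of "smult (inverse c)"] assms(1) by simp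

lemma all_lessThan_3: "(\<forall>i<3. P i) \<longleftrightarrow> P 0 \<and> P 1 \<and> P (2::nat)"
  by (auto simp: eval_nat_numeral less_Suc_eq)

lemma prod_lessThan_3: "(\<Prod>i<3. h i) = h 0 * h 1 * h (2::nat)"
  by (simp add: eval_nat_numeral lessThan_Suc mult_ac)

lemma sum_lessThan_3: "(\<Sum>i<3. h i) = h 0 + h 1 + h (2::nat)"
  by (simp add: eval_nat_numeral lessThan_Suc add_ac)

text \<open>The special weights matter here: f3 enters both \<open>s = f1 f3\<close> and
  \<open>d = f2 f3\<close>, and its weight N + 1 is exactly the cost 1 in \<open>s\<close> plus the
  cost N in \<open>d\<close>. The products are squarefree because the components are squarefree and
  coprime.\<close>

lemma power_free_decomp_imp_squarefree_pair:
  fixes f :: "'a::field poly"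
  assumes "power_free_decomp 4 f a fs"
  shows "\<exists>s d. lead_coeff s = 1 \<and> squarefree s \<and> lead_coeff d = 1 \<and> squarefree d \<and>
    f = smult a (s * d\<^sup>2) \<and>
    (\<Sum>i<4 - 1. [1, N, N + 1] ! i * degree (fs ! i)) = degree s + N * degree d"
proof -
  note A = assms[unfolded power_free_decomp_def, simplified, unfolded all_lessThan_3 prod_lessThan_3, simplified]
  let ?s = "fs ! 0 * fs ! 2" and ?d = "fs ! 1 * fs ! 2"
  have nz: "fs ! 0 \<noteq> 0" "fs ! 1 \<noteq> 0" "fs ! 2 \<noteq> 0" using A by auto
  show ?thesis
  proof (intro exI conjI)
    show "lead_coeff ?s = 1" "lead_coeff ?d = 1" using A by (auto simp: lead_coeff_mult)
    show "squarefree ?s" "squarefree ?d" using A by (auto intro!: squarefree_mult_coprime_poly)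
    show "f = smult a (?s * ?d\<^sup>2)" using A by (simp add: power_mult_distrib eval_nat_numeral algebra_simps)
    show "(\<Sum>i<4 - 1. [1, N, N + 1] ! i * degree (fs ! i)) = degree ?s + N * degree ?d"
    proof -
      have "degree ?s = degree (fs ! 0) + degree (fs ! 2)" "degree ?d = degree (fs ! 1) + degree (fs ! 2)"
        using nz by (simp_all add: degree_mult_eq)
      moreover have "4 - 1 = (3::nat)" by simp
      ultimately show ?thesis by (simp only: sum_lessThan_3) (simp add: algebra_simps)
    qed
  qed
qed

text \<open>A monic common divisor of largest degree serves as the gcd: a nonconstant common factor
  of the cofactors could be multiplied into it. Since \<open>s\<close> is nonzero, the degrees of
  common divisors are bounded.\<close>

lemma gcd_exists_poly:
  fixes s d :: "'a::field poly"
  assumes "s \<noteq> 0"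
  obtains g x y where "lead_coeff g = 1" "s = x * g" "d = y * g" "coprime x y"
proof -
  let ?P = "\<lambda>g. lead_coeff g = 1 \<and> g dvd s \<and> g dvd d"
  have "?P 1" by simp
  moreover have "\<forall>g. ?P g \<longrightarrow> degree g < Suc (degree s)"
    using assms by (auto simp: less_Suc_eq_le dvd_imp_degree_le)
  ultimately have "\<exists>g. ?P g \<and> (\<forall>h. ?P h \<longrightarrow> degree h \<le> degree g)"
    by (rule Lattices_Big.ex_has_greatest_nat)
  then obtain g where g: "?P g" and gmax: "\<And>h. ?P h \<Longrightarrow> degree h \<le> degree g"
    by (elim exE conjE) auto
  obtain x y where xy: "s = x * g" "d = y * g" using g(1) by (metis dvdE mult.commute)
  have "coprime x y"
  proof (rule coprimeI)
    fix c assume c: "c dvd x" "c dvd y"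
    then have "c \<noteq> 0" using xy(1) assms by auto
    then obtain b h where h: "b \<noteq> 0" "lead_coeff h = 1" "c = smult b h" by (rule monic_scale)
    have "h dvd x" "h dvd y" using c h by (auto simp: smult_dvd_iff)
    then have "?P (h * g)" using h g xy by (auto simp: lead_coeff_mult)
    then have "degree (h * g) \<le> degree g" by (rule gmax)
    moreover have "h \<noteq> 0" "g \<noteq> 0" using h g by auto
    ultimately have "degree c = 0" using h by (simp add: degree_mult_eq)
    then show "is_unit c" using \<open>c \<noteq> 0\<close> by (simp add: is_unit_iff_degree)
  qed
  then show ?thesis using that g(1) xy by blast
qed

lemma squarefree_mult_imp_coprime:
  fixes x y :: "'a::field poly"
  assumes "squarefree (x * y)"
  shows "coprime x y"
proof (rule coprimeI)
  fix c assume "c dvd x" "c dvd y"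
  then have "c\<^sup>2 dvd x * y" by (simp add: power2_eq_square mult_dvd_mono)
  then show "is_unit c" using assms squarefreeD by blast
qed

text \<open>The inverse construction takes f3 as the gcd of \<open>s\<close> and \<open>d\<close>,
  and f1, f2 as the cofactors. The cofactors are coprime to each other by the choice of the gcd, and
  coprime to f3 because \<open>s\<close> and \<open>d\<close> are squarefree.\<close>

lemma squarefree_pair_imp_power_free_decomp:
  fixes s d :: "'a::field poly"
  assumes "a \<noteq> 0" "lead_coeff s = 1" "squarefree s" "lead_coeff d = 1" "squarefree d"
  shows "\<exists>fs. power_free_decomp 4 (smult a (s * d\<^sup>2)) a fs"
proof -
  have "s \<noteq> 0" using assms by auto
  then obtain g x y where g: "lead_coeff g = 1" "s = x * g" "d = y * g" "coprime x y"
    by (rule gcd_exists_poly)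
  have "coprime x g" "coprime y g"
    using assms g squarefree_mult_imp_coprime by auto
  moreover have "squarefree x" "squarefree y" "squarefree g"
    using assms g by (auto dest: squarefree_multD)
  moreover have "lead_coeff x = 1" "lead_coeff y = 1" using assms g by (auto simp: lead_coeff_mult)
  ultimately have "power_free_decomp 4 (smult a (s * d\<^sup>2)) a [x, y, g]"
    unfolding power_free_decomp_def g(2,3) using assms(1) g(1,4)
    by (simp add: all_lessThan_3 prod_lessThan_3 coprime_commute)
      (simp add: power_mult_distrib power2_eq_square power3_eq_cube mult_ac)
  then show ?thesis by blast
qed

text \<open>The description by \<open>THE\<close> needs one value for all decompositions. Any
  decomposition yields a pair \<open>s'\<close>, \<open>d'\<close> for the same polynomial;
  comparing leading coefficients and using uniqueness of the square decomposition identifies it with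
  \<open>s\<close>, \<open>d\<close>. Uniqueness of the list itself is thereby bypassed.\<close>

lemma weighted_degree_squarefree_pair:
  fixes s d :: "'a::field poly"
  assumes "a \<noteq> 0" "lead_coeff s = 1" "squarefree s" "lead_coeff d = 1" "squarefree d"
  shows "weighted_degree 4 [1, N, N + 1] (smult a (s * d\<^sup>2)) = degree s + N * degree d"
proof -
  have key: "(\<Sum>i<4 - 1. [1, N, N + 1] ! i * degree (fs ! i)) = degree s + N * degree d"
    if "power_free_decomp 4 (smult a (s * d\<^sup>2)) b fs" for b fs
  proof -
    from power_free_decomp_imp_squarefree_pair[OF that] obtain s' d' where
      sd': "lead_coeff s' = 1" "squarefree s'" "lead_coeff d' = 1" "squarefree d'"
      "smult a (s * d\<^sup>2) = smult b (s' * d'\<^sup>2)"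
      "(\<Sum>i<4 - 1. [1, N, N + 1] ! i * degree (fs ! i)) = degree s' + N * degree d'" by blast
    have "lead_coeff (smult a (s * d\<^sup>2)) = a" "lead_coeff (smult b (s' * d'\<^sup>2)) = b"
      unfolding lead_coeff_smult lead_coeff_mult lead_coeff_power using sd' assms by simp_all
    then have "a = b" using sd'(5) by metis
    then have "s * d\<^sup>2 = s' * d'\<^sup>2"
      using sd'(5) by (auto intro: smult_left_cancel_field[OF assms(1)])
    note squarefree_square_decomposition_unique[OF assms(3) sd'(2) assms(4) sd'(3) this]
    then show ?thesis using sd'(6) by metis
  qed
  obtain fs where fs: "power_free_decomp 4 (smult a (s * d\<^sup>2)) a fs"
    using squarefree_pair_imp_power_free_decomp[OF assms] by blast
  show ?thesis unfolding weighted_degree_def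
  proof (rule the_equality)
    show "\<exists>b fs. power_free_decomp 4 (smult a (s * d\<^sup>2)) b fs \<and>
        degree s + N * degree d = (\<Sum>i<4 - 1. [1, N, N + 1] ! i * degree (fs ! i))"
      using fs key[OF fs] by (intro exI[of _ a] exI[of _ fs]) simp
  qed (metis key)
qed

subsection \<open>Power-free polynomials as pairs of squarefree polynomials\<close>

definition squarefree_pairs :: "nat \<Rightarrow> nat \<Rightarrow> ('a::field poly \<times> 'a poly) set" where
  "squarefree_pairs N n = {(s, d). lead_coeff s = 1 \<and> squarefree s \<and> lead_coeff d = 1 \<and> squarefree d \<and>
     degree s + N * degree d = n}"

lemma F_hat_eq:
  "F_hat n 4 [1, N, N + 1] =
    (\<lambda>(a, s, d). smult a (s * d\<^sup>2)) ` ((- {0}) \<times> (squarefree_pairs N n :: ('a::field poly \<times> 'a poly) set))"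
proof (intro set_eqI iffI)
  fix f :: "'a poly"
  assume f: "f \<in> F_hat n 4 [1, N, N + 1]"
  have "power_free 4 f" using f by (simp add: F_hat_def)
  then have "f \<noteq> 0" unfolding power_free_def by (metis dvd_0_right not_is_unit_0)
  then obtain a r where a: "a \<noteq> 0" "lead_coeff r = 1" "f = smult a r" by (rule monic_scale)
  obtain s d where sd: "lead_coeff s = 1" "squarefree s" "lead_coeff d = 1" "r = s * d\<^sup>2"
    using squarefree_square_decomposition_exists[OF a(2)] by blast
  have "d \<noteq> 0" using sd by auto
  then have d: "squarefree d" using f a sd power_free_4_iff[of s d a] by (simp add: F_hat_def)
  have "weighted_degree 4 [1, N, N + 1] f = degree s + N * degree d"
    unfolding a(3) sd(4) using weighted_degree_squarefree_pair sd d a by blast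
  then have "(s, d) \<in> squarefree_pairs N n" using sd d f by (auto simp: squarefree_pairs_def F_hat_def)
  then show "f \<in> (\<lambda>(a, s, d). smult a (s * d\<^sup>2)) ` ((- {0}) \<times> squarefree_pairs N n)"
    using a sd by (intro image_eqI[of _ _ "(a, s, d)"]) auto
next
  fix f :: "'a poly"
  assume "f \<in> (\<lambda>(a, s, d). smult a (s * d\<^sup>2)) ` ((- {0}) \<times> squarefree_pairs N n)"
  then obtain a s d where *: "a \<noteq> 0" "(s, d) \<in> squarefree_pairs N n" "f = smult a (s * d\<^sup>2)" by auto
  then have sd: "lead_coeff s = 1" "squarefree s" "lead_coeff d = 1" "squarefree d"
    "degree s + N * degree d = n" by (auto simp: squarefree_pairs_def)
  have "d \<noteq> 0" using sd by auto
  then show "f \<in> F_hat n 4 [1, N, N + 1]"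
    using *(1,3) sd power_free_4_iff[of s d a] weighted_degree_squarefree_pair[of a s d N]
    by (simp add: F_hat_def)
qed

lemma lead_coeff_squarefree_pair:
  assumes "(s, d) \<in> squarefree_pairs N n"
  shows "lead_coeff (smult a (s * d\<^sup>2)) = a"
  using assms by (auto simp: squarefree_pairs_def lead_coeff_mult lead_coeff_power)

lemma F_monic_eq:
  "F_monic n 4 [1, N, N + 1] =
    (\<lambda>(s, d). s * d\<^sup>2) ` (squarefree_pairs N n :: ('a::field poly \<times> 'a poly) set)"
proof (intro set_eqI iffI)
  fix f :: "'a poly"
  assume "f \<in> F_monic n 4 [1, N, N + 1]"
  then have f: "f \<in> F_hat n 4 [1, N, N + 1]" "lead_coeff f = 1" by (simp_all add: F_monic_def)
  from f(1) obtain a s d where *: "(s, d) \<in> squarefree_pairs N n" "f = smult a (s * d\<^sup>2)"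
    unfolding F_hat_eq by auto
  then have "a = 1" using f(2) lead_coeff_squarefree_pair[OF *(1), of a] by metis
  then show "f \<in> (\<lambda>(s, d). s * d\<^sup>2) ` squarefree_pairs N n"
    using * by (intro image_eqI[of _ _ "(s, d)"]) simp_all
next
  fix f :: "'a poly"
  assume "f \<in> (\<lambda>(s, d). s * d\<^sup>2) ` squarefree_pairs N n"
  then obtain s d where *: "(s, d) \<in> squarefree_pairs N n" "f = smult 1 (s * d\<^sup>2)" by auto
  then have "lead_coeff f = 1" using lead_coeff_squarefree_pair by metis
  moreover have "f \<in> F_hat n 4 [1, N, N + 1]" unfolding F_hat_eq
    using * by (intro image_eqI[of _ _ "(1, s, d)"]) simp_all
  ultimately show "f \<in> F_monic n 4 [1, N, N + 1]" by (simp add: F_monic_def)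
qed

lemma inj_on_squarefree_pairs:
  "inj_on (\<lambda>(a, s, d). smult a (s * d\<^sup>2)) ((- {0}) \<times> (squarefree_pairs N n :: ('a::field poly \<times> 'a poly) set))"
proof -
  have "a = b \<and> s = s' \<and> d = d'"
    if *: "a \<noteq> 0" "b \<noteq> 0" "(s, d) \<in> squarefree_pairs N n" "(s', d') \<in> squarefree_pairs N n"
      "smult a (s * d\<^sup>2) = smult b (s' * d'\<^sup>2)" for a b :: 'a and s d s' d'
  proof -
    have ab: "a = b" using lead_coeff_squarefree_pair[OF *(3), of a] lead_coeff_squarefree_pair[OF *(4), of b] *(5)
      by metis
    then have "s * d\<^sup>2 = s' * d'\<^sup>2" using *(5) by (auto intro: smult_left_cancel_field[OF *(1)])
    then show ?thesis
      using ab squarefree_square_decomposition_unique[of s s' d d'] *(3,4)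
      by (auto simp: squarefree_pairs_def)
  qed
  then show ?thesis by (intro inj_onI) auto
qed

subsection \<open>Polynomials with prescribed values\<close>

definition monic_polys :: "nat \<Rightarrow> 'a::field poly set" where
  "monic_polys n = {p. lead_coeff p = 1 \<and> degree p = n}"

lemma monic_polys_0: "monic_polys 0 = {1 :: 'a::field poly}"
proof -
  have "p = 1" if "lead_coeff p = 1" "degree p = 0" for p :: "'a poly"
    using that by (metis degree_0_id one_pCons)
  then show ?thesis by (auto simp: monic_polys_def)
qed

lemma monic_polys_Suc:
  "monic_polys (Suc n) = (\<lambda>(c, p). pCons c p) ` (UNIV \<times> (monic_polys n :: 'a::field poly set))"
proof (intro set_eqI iffI)
  fix p :: "'a poly"
  assume p: "p \<in> monic_polys (Suc n)"
  obtain c r where r: "p = pCons c r" by (cases p)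
  have "r \<noteq> 0" using p r by (auto simp: monic_polys_def)
  then have "r \<in> monic_polys n" using p r by (auto simp: monic_polys_def)
  then show "p \<in> (\<lambda>(c, p). pCons c p) ` (UNIV \<times> monic_polys n)" using r by auto
next
  fix p :: "'a poly"
  assume "p \<in> (\<lambda>(c, p). pCons c p) ` (UNIV \<times> monic_polys n)"
  then obtain c r where r: "p = pCons c r" "r \<in> monic_polys n" by auto
  then have "r \<noteq> 0" by (auto simp: monic_polys_def)
  then show "p \<in> monic_polys (Suc n)" using r by (auto simp: monic_polys_def)
qed

lemma finite_monic_polys: "finite (monic_polys n :: 'a::{field,finite} poly set)"
  by (induction n) (simp_all add: monic_polys_0 monic_polys_Suc)

lemma card_monic_polys: "card (monic_polys n :: 'a::{field,finite} poly set) = CARD('a) ^ n"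
proof (induction n)
  case (Suc n)
  have "inj_on (\<lambda>(c, p). pCons c p) (UNIV \<times> (monic_polys n :: 'a poly set))"
    by (auto simp: inj_on_def)
  then show ?case by (simp add: monic_polys_Suc card_image card_cartesian_product Suc.IH)
qed (simp add: monic_polys_0)

definition root_poly :: "'a::field set \<Rightarrow> 'a poly" where
  "root_poly Z = (\<Prod>z\<in>Z. [:- z, 1:])"

lemma lead_coeff_root_poly: "lead_coeff (root_poly Z) = 1"
  by (simp add: root_poly_def lead_coeff_prod)

lemma root_poly_nonzero: "root_poly Z \<noteq> 0"
  using lead_coeff_root_poly[of Z] by auto

lemma degree_root_poly: "degree (root_poly Z) = card Z"
  unfolding root_poly_def by (subst degree_prod_eq_sum_degree) auto

lemma poly_root_poly_eq_0_iff: "finite Z \<Longrightarrow> poly (root_poly Z) x = 0 \<longleftrightarrow> x \<in> Z"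
  by (auto simp: root_poly_def poly_prod)

lemma root_poly_insert: "finite Z \<Longrightarrow> x \<notin> Z \<Longrightarrow> root_poly (insert x Z) = [:- x, 1:] * root_poly Z"
  by (simp add: root_poly_def)

text \<open>Newton interpolation: a multiple of \<open>root_poly Z\<close> corrects the value at a
  new point and leaves the old ones alone. The alternative \<open>p = 0\<close> covers the empty
  set, where no degree lies below \<open>card Z\<close>.\<close>

lemma interpolation_exists:
  fixes a :: "'a::field \<Rightarrow> 'a"
  assumes "finite Z"
  shows "\<exists>p. (\<forall>z\<in>Z. poly p z = a z) \<and> (degree p < card Z \<or> p = 0)"
  using assms
proof (induction Z)
  case (insert x Z)
  then obtain p where p: "\<forall>z\<in>Z. poly p z = a z" "degree p < card Z \<or> p = 0" by blast
  define c where "c = (a x - poly p x) / poly (root_poly Z) x"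
  have nz: "poly (root_poly Z) x \<noteq> 0" using insert by (simp add: poly_root_poly_eq_0_iff)
  have "poly (p + smult c (root_poly Z)) z = a z" if "z \<in> insert x Z" for z
  proof (cases "z = x")
    case True then show ?thesis using nz by (simp add: c_def)
  next
    case False
    then have "z \<in> Z" using that by simp
    then have "poly (root_poly Z) z = 0" using insert by (simp add: poly_root_poly_eq_0_iff)
    then show ?thesis using p \<open>z \<in> Z\<close> by simp
  qed
  moreover have "degree (p + smult c (root_poly Z)) < card (insert x Z)"
  proof -
    have "degree p \<le> card Z" using p(2) by auto
    moreover have "degree (smult c (root_poly Z)) \<le> card Z"
      using degree_smult_le[of c "root_poly Z"] by (simp add: degree_root_poly)
    ultimately show ?thesis using insert degree_add_le[of p "card Z"] by (simp add: less_Suc_eq_le)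
  qed
  ultimately show ?case by blast
qed auto

text \<open>Adding an interpolating polynomial of \<open>b - a\<close> turns values \<open>a\<close>
  into values \<open>b\<close>. Its degree is below q and hence below n (or it is zero), so the sum
  stays monic of degree n. The inequality is later used with \<open>a\<close> and \<open>b\<close>
  in both orders.\<close>

lemma card_monic_polys_values_eq:
  fixes a b :: "'a::{field,finite} \<Rightarrow> 'a"
  assumes "CARD('a) \<le> n"
  shows "card {p \<in> monic_polys n. poly p = a} \<le> card {p \<in> monic_polys n. poly p = b}"
proof -
  obtain i where i: "\<forall>z\<in>UNIV. poly i z = b z - a z" "degree i < CARD('a) \<or> i = 0"
    using interpolation_exists[of UNIV "\<lambda>z. b z - a z"] by auto
  have "p + i \<in> {p \<in> monic_polys n. poly p = b}" if p: "p \<in> monic_polys n" "poly p = a" for p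
  proof -
    have "degree i < degree p \<or> i = 0" using i(2) assms p by (auto simp: monic_polys_def)
    then have "degree (p + i) = degree p" "lead_coeff (p + i) = lead_coeff p"
      by (auto simp: degree_add_eq_left coeff_eq_0)
    then show ?thesis using p i(1) by (auto simp: monic_polys_def)
  qed
  then show ?thesis
    by (intro card_inj_on_le[of "\<lambda>p. p + i"]) (auto simp: inj_on_def finite_monic_polys)
qed

text \<open>The q^n monic polynomials are spread evenly over the q^q functions.\<close>

lemma card_monic_polys_values:
  fixes a :: "'a::{field,finite} \<Rightarrow> 'a"
  assumes "CARD('a) \<le> n"
  shows "card {p \<in> monic_polys n. poly p = a} = CARD('a) ^ (n - CARD('a))"
proof -
  have "CARD('a) ^ n = card (\<Union>b. {p \<in> monic_polys n. poly p = (b :: 'a \<Rightarrow> 'a)})"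
    by (simp add: card_monic_polys[symmetric]) (rule arg_cong[of _ _ card], auto)
  also have "\<dots> = (\<Sum>b\<in>UNIV. card {p \<in> monic_polys n. poly p = (b :: 'a \<Rightarrow> 'a)})"
    by (rule card_UN_disjoint) (auto simp: finite_monic_polys)
  also have "\<dots> = (\<Sum>b\<in>(UNIV :: ('a \<Rightarrow> 'a) set). card {p \<in> monic_polys n. poly p = a})"
    by (intro sum.cong refl antisym card_monic_polys_values_eq assms)
  also have "\<dots> = CARD('a) ^ CARD('a) * card {p \<in> monic_polys n. poly p = a}"
    by (simp add: card_fun)
  finally have "CARD('a) ^ CARD('a) * card {p \<in> monic_polys n. poly p = a} =
      CARD('a) ^ CARD('a) * CARD('a) ^ (n - CARD('a))"
    using assms by (simp add: power_add[symmetric])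
  then show ?thesis by simp
qed

section \<open>Root-free polynomials counted by their values\<close>

definition nonvanishing_polys :: "nat \<Rightarrow> 'a::field poly set" where
  "nonvanishing_polys n = {p \<in> monic_polys n. \<forall>x. poly p x \<noteq> 0}"

definition squarefree_nonvanishing :: "nat \<Rightarrow> 'a::field poly set" where
  "squarefree_nonvanishing n = {p \<in> nonvanishing_polys n. squarefree p}"

text \<open>This is the number u_n(a) of the overview.\<close>

definition squarefree_count :: "nat \<Rightarrow> ('a::field \<Rightarrow> 'a) \<Rightarrow> nat" where
  "squarefree_count n a = card {p \<in> squarefree_nonvanishing n. poly p = a}"

lemma finite_nonvanishing_polys: "finite (nonvanishing_polys n :: 'a::{field,finite} poly set)"
  by (simp add: nonvanishing_polys_def finite_monic_polys)

lemma finite_squarefree_nonvanishing: "finite (squarefree_nonvanishing n :: 'a::{field,finite} poly set)"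
  by (simp add: squarefree_nonvanishing_def finite_nonvanishing_polys)

lemma card_nonvanishing_polys_le:
  "card (nonvanishing_polys n :: 'a::{field,finite} poly set) \<le> CARD('a) ^ n"
  unfolding nonvanishing_polys_def card_monic_polys[symmetric]
  by (intro card_mono finite_monic_polys) auto

lemma card_squarefree_nonvanishing_le:
  "card (squarefree_nonvanishing n :: 'a::{field,finite} poly set) \<le> CARD('a) ^ n"
proof -
  have "card (squarefree_nonvanishing n :: 'a poly set) \<le> card (nonvanishing_polys n :: 'a poly set)"
    unfolding squarefree_nonvanishing_def by (intro card_mono finite_nonvanishing_polys) auto
  then show ?thesis using card_nonvanishing_polys_le le_trans by blast
qed

lemma squarefree_count_le:
  "squarefree_count n (a :: 'a::{field,finite} \<Rightarrow> 'a) \<le> CARD('a) ^ n"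
proof -
  have "squarefree_count n a \<le> card (squarefree_nonvanishing n :: 'a poly set)"
    unfolding squarefree_count_def by (intro card_mono finite_squarefree_nonvanishing) auto
  then show ?thesis using card_squarefree_nonvanishing_le le_trans by blast
qed

lemma nonvanishing_polys_0: "nonvanishing_polys 0 = {1 :: 'a::field poly}"
  by (auto simp: nonvanishing_polys_def monic_polys_0)

text \<open>This removes the index 1 from the recursion, leaving weights that sum to at most
  1/2.\<close>

lemma nonvanishing_polys_1: "nonvanishing_polys (Suc 0) = ({} :: 'a::field poly set)"
proof -
  have "\<exists>x. poly p x = 0" if p: "p \<in> monic_polys (Suc 0)" for p :: "'a poly"
  proof -
    obtain c where "p = [:c, 1:]"
      using p unfolding monic_polys_Suc monic_polys_0 by (auto simp: one_pCons)
    then show ?thesis by (intro exI[of _ "- c"]) simp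
  qed
  then show ?thesis by (auto simp: nonvanishing_polys_def)
qed

text \<open>Each polynomial with values \<open>a\<close> is \<open>s * d^2\<close> in exactly one
  way, with \<open>s\<close> squarefree and \<open>d\<close> monic. As \<open>a\<close> has no
  zeros, both factors are root-free, and \<open>d\<close> then dictates the values of
  \<open>s\<close>. The left side is the even distribution of values.\<close>

lemma sum_squarefree_count:
  fixes a :: "'a::{field,finite} \<Rightarrow> 'a"
  assumes a: "\<And>x. a x \<noteq> 0" and n: "CARD('a) \<le> n"
  shows "CARD('a) ^ (n - CARD('a)) =
    (\<Sum>j\<le>n div 2. \<Sum>d\<in>nonvanishing_polys j. squarefree_count (n - 2 * j) (\<lambda>x. a x / (poly d x)\<^sup>2))"
proof -
  let ?S = "\<lambda>j d. {p \<in> squarefree_nonvanishing (n - 2 * j). poly p = (\<lambda>x. a x / (poly d x)\<^sup>2)}"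
  let ?T = "SIGMA j:{..n div 2}. SIGMA d:nonvanishing_polys j. ?S j d"
  let ?f = "\<lambda>(j, d, s). s * (d :: 'a poly)\<^sup>2"
  have "bij_betw ?f ?T {p \<in> monic_polys n. poly p = a}"
  proof (rule bij_betw_imageI)
    show "inj_on ?f ?T"
    proof (rule inj_onI)
      fix u v assume uv: "u \<in> ?T" "v \<in> ?T" "?f u = ?f v"
      obtain j d s where u: "u = (j, d, s)" by (cases u)
      obtain j' d' s' where v: "v = (j', d', s')" by (cases v)
      have eq: "s * d\<^sup>2 = s' * d'\<^sup>2" using uv u v by simp
      have "squarefree s" "squarefree s'" "lead_coeff d = 1" "lead_coeff d' = 1"
        "degree d = j" "degree d' = j'"
        using uv(1,2) u v by (auto simp: squarefree_nonvanishing_def nonvanishing_polys_def monic_polys_def)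
      with squarefree_square_decomposition_unique[OF this(1-4) eq]
      show "u = v" using u v by simp
    qed
    show "?f ` ?T = {p \<in> monic_polys n. poly p = a}"
    proof (intro set_eqI iffI)
      fix p assume "p \<in> ?f ` ?T"
      then obtain j d s where *: "p = s * d\<^sup>2" "j \<le> n div 2" "d \<in> nonvanishing_polys j" "s \<in> ?S j d" by auto
      then have d: "lead_coeff d = 1" "degree d = j" "\<And>x. poly d x \<noteq> 0"
        and s: "lead_coeff s = 1" "degree s = n - 2 * j" "\<And>x. poly s x = a x / (poly d x)\<^sup>2"
        by (auto simp: squarefree_nonvanishing_def nonvanishing_polys_def monic_polys_def)
      have "d \<noteq> 0" "s \<noteq> 0" using d s by auto
      then have "degree p = n" using * d s by (simp add: degree_mult_eq degree_power_eq)
      moreover have "lead_coeff p = 1" unfolding *(1) lead_coeff_mult lead_coeff_power using d s by simp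
      moreover have "poly p = a" using d s by (auto simp: *(1))
      ultimately show "p \<in> {p \<in> monic_polys n. poly p = a}" by (simp add: monic_polys_def)
    next
      fix p assume "p \<in> {p \<in> monic_polys n. poly p = a}"
      then have p: "lead_coeff p = 1" "degree p = n" "poly p = a" by (auto simp: monic_polys_def)
      obtain s d where sd: "lead_coeff s = 1" "squarefree s" "lead_coeff d = 1" "p = s * d\<^sup>2"
        using squarefree_square_decomposition_exists[OF p(1)] by blast
      have nz: "s \<noteq> 0" "d \<noteq> 0" using sd by auto
      have "degree p = degree s + 2 * degree d"
        unfolding sd(4) using nz by (simp add: degree_mult_eq degree_power_eq)
      then have deg: "degree s = n - 2 * degree d" "degree d \<le> n div 2" using p(2) by auto
      have val: "a x = poly s x * (poly d x)\<^sup>2" for x using p(3) sd(4) by auto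
      have nv: "poly d x \<noteq> 0" "poly s x \<noteq> 0" for x using a[of x] unfolding val by auto
      have "poly s = (\<lambda>x. a x / (poly d x)\<^sup>2)" using nv by (auto simp: val)
      then have "(degree d, d, s) \<in> ?T"
        using deg sd nv by (simp add: squarefree_nonvanishing_def nonvanishing_polys_def monic_polys_def)
      then show "p \<in> ?f ` ?T" by (intro image_eqI[of _ _ "(degree d, d, s)"]) (simp_all add: sd(4))
    qed
  qed
  then have "card {p \<in> monic_polys n. poly p = a} = card ?T" by (simp add: bij_betw_same_card)
  also have "\<dots> = (\<Sum>j\<le>n div 2. \<Sum>d\<in>nonvanishing_polys j. card (?S j d))"
    by (subst card_SigmaI, simp, intro ballI finite_SigmaI finite_nonvanishing_polys)
      (simp_all add: card_SigmaI finite_nonvanishing_polys finite_squarefree_nonvanishing)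
  finally show ?thesis using n by (simp add: card_monic_polys_values squarefree_count_def)
qed

definition nonvanishing_pairs :: "nat \<Rightarrow> nat \<Rightarrow> ('a::field poly \<times> 'a poly) set" where
  "nonvanishing_pairs N n = {(s, d) \<in> squarefree_pairs N n. \<forall>x. poly s x \<noteq> 0 \<and> poly d x \<noteq> 0}"

lemma finite_squarefree_pairs:
  assumes "N > 0"
  shows "finite (squarefree_pairs N n :: ('a::{field,finite} poly \<times> 'a poly) set)"
proof (rule finite_subset)
  have "degree d \<le> N * degree d" for d :: "'a poly" using assms by simp
  then have "degree s \<le> n \<and> degree d \<le> n" if "degree s + N * degree d = n" for s d :: "'a poly"
    using that by (metis add_leD2 le_add1 le_trans le_add2)
  then show "squarefree_pairs N n \<subseteq> (\<Union>i\<le>n. monic_polys i) \<times> (\<Union>i\<le>n. (monic_polys i :: 'a poly set))"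
    by (auto simp: squarefree_pairs_def monic_polys_def)
qed (simp add: finite_monic_polys)

definition pair_count :: "nat \<Rightarrow> nat \<Rightarrow> ('a::field \<Rightarrow> 'a) \<Rightarrow> nat" where
  "pair_count N n a = card {(s, d) \<in> nonvanishing_pairs N n. \<forall>x. poly s x * (poly d x)\<^sup>2 = a x}"

text \<open>The sorting has the same shape as in \<open>sum_squarefree_count\<close>, but
  \<open>d\<close> is now squarefree and costs N per degree. The total is here the unknown,
  expressed through counts whose limit is available.\<close>

lemma pair_count_eq:
  fixes a :: "'a::{field,finite} \<Rightarrow> 'a"
  assumes N: "N > 0"
  shows "pair_count N n a =
    (\<Sum>j\<le>n div N. \<Sum>d\<in>squarefree_nonvanishing j. squarefree_count (n - N * j) (\<lambda>x. a x / (poly d x)\<^sup>2))"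
proof -
  let ?S = "\<lambda>j d. {p \<in> squarefree_nonvanishing (n - N * j). poly p = (\<lambda>x. a x / (poly d x)\<^sup>2)}"
  let ?T = "SIGMA j:{..n div N}. SIGMA d:squarefree_nonvanishing j. ?S j d"
  let ?P = "{(s, d) \<in> nonvanishing_pairs N n. \<forall>x. poly s x * (poly d x)\<^sup>2 = a x}"
  let ?f = "\<lambda>(j, d, s). (s, d :: 'a poly)"
  have "bij_betw ?f ?T ?P"
  proof (rule bij_betw_imageI)
    show "inj_on ?f ?T"
      by (rule inj_onI) (auto simp: squarefree_nonvanishing_def nonvanishing_polys_def monic_polys_def)
    show "?f ` ?T = ?P"
    proof (intro set_eqI iffI)
      fix p assume "p \<in> ?f ` ?T"
      then obtain j d s where *: "p = (s, d)" "j \<le> n div N" "d \<in> squarefree_nonvanishing j" "s \<in> ?S j d" by auto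
      then have d: "lead_coeff d = 1" "degree d = j" "\<And>x. poly d x \<noteq> 0" "squarefree d"
        and s: "lead_coeff s = 1" "degree s = n - N * j" "\<And>x. poly s x = a x / (poly d x)\<^sup>2"
          "\<And>x. poly s x \<noteq> 0" "squarefree s"
        by (auto simp: squarefree_nonvanishing_def nonvanishing_polys_def monic_polys_def)
      have "N * j \<le> n" using *(2) N by (metis less_eq_div_iff_mult_less_eq mult.commute)
      then have "(s, d) \<in> nonvanishing_pairs N n"
        unfolding nonvanishing_pairs_def squarefree_pairs_def using d(1,2,4) s(1,2,5) d(3) s(4) by simp
      moreover have "poly s x * (poly d x)\<^sup>2 = a x" for x using s(3)[of x] d(3)[of x] by simp
      ultimately show "p \<in> ?P" using *(1) by simp
    next
      fix p assume "p \<in> ?P"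
      then obtain s d where *: "p = (s, d)" "(s, d) \<in> nonvanishing_pairs N n"
        "\<And>x. poly s x * (poly d x)\<^sup>2 = a x" by auto
      have sd: "lead_coeff s = 1" "squarefree s" "lead_coeff d = 1" "squarefree d" "degree s + N * degree d = n"
        "\<And>x. poly s x \<noteq> 0" "\<And>x. poly d x \<noteq> 0"
        using *(2) by (simp_all add: nonvanishing_pairs_def squarefree_pairs_def)
      have "poly s = (\<lambda>x. a x / (poly d x)\<^sup>2)" using sd(7) by (auto simp: *(3)[symmetric])
      moreover have "N * degree d \<le> n" using sd(5) by simp
      then have "degree d \<le> n div N" using N by (metis less_eq_div_iff_mult_less_eq mult.commute)
      moreover have "degree s = n - N * degree d" using sd(5) by simp
      ultimately have "(degree d, d, s) \<in> ?T"
        using sd by (simp add: squarefree_nonvanishing_def nonvanishing_polys_def monic_polys_def)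
      then show "p \<in> ?f ` ?T" using *(1) by (intro image_eqI[of _ _ "(degree d, d, s)"]) simp_all
    qed
  qed
  then have "pair_count N n a = card ?T" by (simp add: bij_betw_same_card pair_count_def)
  also have "\<dots> = (\<Sum>j\<le>n div N. \<Sum>d\<in>squarefree_nonvanishing j. card (?S j d))"
    by (subst card_SigmaI, simp, intro ballI finite_SigmaI finite_squarefree_nonvanishing)
      (simp_all add: card_SigmaI finite_squarefree_nonvanishing)
  finally show ?thesis by (simp add: squarefree_count_def)
qed

subsection \<open>Splitting off roots\<close>

lemma root_poly_dvd:
  fixes p :: "'a::field poly"
  assumes "finite Z" "\<And>z. z \<in> Z \<Longrightarrow> poly p z = 0"
  shows "root_poly Z dvd p"
  using assms
proof (induction Z)
  case (insert x Z)
  then obtain r where r: "p = root_poly Z * r" by auto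
  have "poly (root_poly Z) x \<noteq> 0" using insert by (simp add: poly_root_poly_eq_0_iff)
  then have "poly r x = 0" using insert.prems[of x] r by simp
  then have "[:- x, 1:] dvd r" by (simp add: poly_eq_0_iff_dvd)
  then have "root_poly Z * [:- x, 1:] dvd root_poly Z * r" by (rule mult_dvd_mono[OF dvd_refl])
  then show ?case unfolding r root_poly_insert[OF insert.hyps] mult.commute[of "[:- x, 1:]"] .
qed (simp add: root_poly_def)

lemma coprime_prime_elem:
  fixes p n :: "'a::field poly"
  assumes "prime_elem p" "\<not> p dvd n"
  shows "coprime p n"
proof (rule coprimeI)
  fix c assume c: "c dvd p" "c dvd n"
  from prime_elem_imp_irreducible[OF assms(1)] c(1) have "p dvd c \<or> is_unit c"
    by (rule irreducibleD')
  then show "is_unit c" using c(2) assms(2) dvd_trans by blast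
qed

lemma squarefree_prime_elem_poly:
  fixes p :: "'a::field poly"
  assumes "prime_elem p"
  shows "squarefree p"
proof (rule squarefreeI)
  fix x assume "x\<^sup>2 dvd p"
  then obtain k where k: "p = x * (x * k)" by (metis dvdE power2_eq_square mult.assoc)
  from irreducibleD[OF prime_elem_imp_irreducible[OF assms] k] show "x dvd 1"
    by (auto dest: dvd_mult_left)
qed

text \<open>Each new linear factor is prime and does not divide the rest, which is nonzero at its
  root.\<close>

lemma squarefree_root_poly_mult:
  fixes p :: "'a::field poly"
  assumes "finite Z" "squarefree p" "\<And>z. z \<in> Z \<Longrightarrow> poly p z \<noteq> 0"
  shows "squarefree (root_poly Z * p)"
  using assms
proof (induction Z)
  case (insert x Z)
  have pr: "prime_elem [:- x, 1:]"
    by (rule prime_elem_linear_field_poly) simp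
  have "poly (root_poly Z * p) x \<noteq> 0" using insert by (simp add: poly_root_poly_eq_0_iff)
  then have "\<not> [:- x, 1:] dvd root_poly Z * p" unfolding poly_eq_0_iff_dvd .
  then have "coprime [:- x, 1:] (root_poly Z * p)" by (rule coprime_prime_elem[OF pr])
  then have "squarefree ([:- x, 1:] * (root_poly Z * p))"
    using insert.IH insert.prems
    by (intro squarefree_mult_coprime_poly[of "[:- x, 1:]"] squarefree_prime_elem_poly[OF pr]) blast+
  then show ?case unfolding root_poly_insert[OF insert.hyps] mult.assoc .
qed (simp add: root_poly_def)

text \<open>A root of the cofactor would already be in \<open>Z\<close> and hence a double root of
  \<open>p\<close>, contradicting squarefreeness.\<close>

lemma squarefree_root_poly_decomposition:
  fixes p :: "'a::{field,finite} poly"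
  assumes "lead_coeff p = 1" "squarefree p"
  defines "Z \<equiv> {x. poly p x = 0}"
  obtains r where "lead_coeff r = 1" "squarefree r" "\<And>x. poly r x \<noteq> 0" "p = root_poly Z * r"
    "degree p = card Z + degree r"
proof -
  have "root_poly Z dvd p" by (rule root_poly_dvd) (auto simp: Z_def)
  then obtain r where r: "p = root_poly Z * r" by blast
  have "poly r x \<noteq> 0" for x
  proof
    assume x: "poly r x = 0"
    then have "poly p x = 0" by (simp add: r)
    then have "x \<in> Z" by (simp add: Z_def)
    then have "[:- x, 1:] dvd root_poly Z"
      unfolding poly_eq_0_iff_dvd[symmetric] by (simp add: poly_root_poly_eq_0_iff)
    moreover have "[:- x, 1:] dvd r" using x unfolding poly_eq_0_iff_dvd .
    ultimately have "[:- x, 1:]\<^sup>2 dvd p" unfolding r power2_eq_square by (rule mult_dvd_mono)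
    then have "is_unit [:- x, 1:]" using assms(2) by (rule squarefreeD[rotated])
    then show False by (simp add: is_unit_iff_degree)
  qed
  moreover have lr: "lead_coeff r = 1" using assms(1) r by (simp add: lead_coeff_mult lead_coeff_root_poly)
  moreover have "squarefree r" using assms(2) unfolding r by (rule squarefree_multD(2))
  moreover have "r \<noteq> 0" using lr by auto
  then have "degree p = card Z + degree r" by (simp add: r degree_mult_eq root_poly_nonzero degree_root_poly)
  ultimately show ?thesis using that r by blast
qed

text \<open>\<open>Y\<close> and \<open>Z\<close> are the possible zero sets of \<open>s\<close> and
  \<open>d\<close>. They may overlap, namely at the zeros of f3.\<close>

definition zero_patterns :: "('a::field \<Rightarrow> 'a) \<Rightarrow> ('a set \<times> 'a set) set" where
  "zero_patterns a = {(Y, Z). Y \<union> Z = {x. a x = 0}}"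

text \<open>These are the possible value functions of \<open>s * d^2\<close> after the roots have
  been split off.\<close>

definition cofactor_values :: "('a::field \<Rightarrow> 'a) \<Rightarrow> 'a set \<Rightarrow> 'a set \<Rightarrow> ('a \<Rightarrow> 'a) set" where
  "cofactor_values a Y Z = {b. (\<forall>x. b x \<noteq> 0) \<and>
     (\<forall>x. poly (root_poly Y) x * (poly (root_poly Z) x)\<^sup>2 * b x = a x)}"

text \<open>At a zero of \<open>a\<close> the root polynomials already supply the zero, so
  \<open>b\<close> is free among the q - 1 nonzero values. Elsewhere \<open>b\<close> is forced to
  be a nonzero quotient. The count is therefore independent of the pattern.\<close>

lemma card_cofactor_values:
  fixes a :: "'a::{field,finite} \<Rightarrow> 'a"
  assumes "(Y, Z) \<in> zero_patterns a"
  shows "card (cofactor_values a Y Z) = (CARD('a) - 1) ^ card {x. a x = 0}"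
proof -
  define r where "r x = poly (root_poly Y) x * (poly (root_poly Z) x)\<^sup>2" for x
  have r0: "r x = 0 \<longleftrightarrow> a x = 0" for x
  proof -
    have "a x = 0 \<longleftrightarrow> x \<in> Y \<or> x \<in> Z" using assms unfolding zero_patterns_def by blast
    then show ?thesis by (simp add: r_def poly_root_poly_eq_0_iff)
  qed
  have "cofactor_values a Y Z = (\<Pi>\<^sub>E x\<in>UNIV. if a x = 0 then - {0} else {a x / r x})"
  proof (intro set_eqI iffI)
    fix b assume b: "b \<in> cofactor_values a Y Z"
    then have *: "b x \<noteq> 0" "r x * b x = a x" for x
      unfolding cofactor_values_def r_def by blast+
    show "b \<in> (\<Pi>\<^sub>E x\<in>UNIV. if a x = 0 then - {0} else {a x / r x})"
    proof (rule PiE_I)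
      fix x
      show "b x \<in> (if a x = 0 then - {0} else {a x / r x})"
        using *[of x] r0[of x] by (simp add: nonzero_eq_divide_eq mult.commute)
    qed simp
  next
    fix b assume b: "b \<in> (\<Pi>\<^sub>E x\<in>UNIV. if a x = 0 then - {0} else {a x / r x})"
    have "b x \<noteq> 0 \<and> r x * b x = a x" for x
      using PiE_mem[OF b, of x] r0[of x] by (simp split: if_splits)
    then show "b \<in> cofactor_values a Y Z" unfolding cofactor_values_def r_def by blast
  qed
  also have "card \<dots> = (\<Prod>x\<in>UNIV. card (if a x = 0 then - {0} else {a x / r x}))"
    by (simp add: card_PiE)
  also have "\<dots> = (\<Prod>x\<in>UNIV. if a x = 0 then CARD('a) - 1 else 1)"
    by (intro prod.cong) (simp_all add: Compl_eq_Diff_UNIV card_Diff_subset)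
  also have "\<dots> = (CARD('a) - 1) ^ card {x. a x = 0}"
    by (simp add: prod.If_cases)
  finally show ?thesis .
qed

text \<open>A pair is determined by its zero sets and its root-free cofactors, and splitting off the
  roots lowers the weighted degree by \<open>card Y + N * card Z\<close>. The cofactors are then
  sorted by the values \<open>b\<close> of their combination.\<close>

lemma card_squarefree_pairs_values:
  fixes a :: "'a::{field,finite} \<Rightarrow> 'a"
  assumes N: "N > 0" and n: "(1 + N) * CARD('a) \<le> n"
  shows "card {(s, d) \<in> squarefree_pairs N n. \<forall>x. poly s x * (poly d x)\<^sup>2 = a x} =
    (\<Sum>(Y, Z)\<in>zero_patterns a. \<Sum>b\<in>cofactor_values a Y Z. pair_count N (n - (card Y + N * card Z)) b)"
proof -
  let ?S = "\<lambda>(Y :: 'a set) (Z :: 'a set) (b :: 'a \<Rightarrow> 'a). {(s, d) \<in> nonvanishing_pairs N (n - (card Y + N * card Z)). \<forall>x. poly s x * (poly d x)\<^sup>2 = b x}"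
  let ?T = "SIGMA (Y, Z):zero_patterns a. SIGMA b:cofactor_values a Y Z. ?S Y Z b"
  let ?P = "{(s, d) \<in> squarefree_pairs N n. \<forall>x. poly s x * (poly d x)\<^sup>2 = a x}"
  let ?f = "\<lambda>((Y, Z), b :: 'a \<Rightarrow> 'a, s, d). (root_poly Y * s, root_poly Z * d)"
  \<comment> \<open>Keeps the natural-number subtraction from truncating: zero sets have at most q
    elements.\<close>
  have bound: "card Y + N * card Z \<le> n" for Y Z :: "'a set"
  proof -
    have "card Y \<le> CARD('a)" "card Z \<le> CARD('a)" by (simp_all add: card_mono)
    then have "card Y + N * card Z \<le> CARD('a) + N * CARD('a)" by (intro add_mono mult_le_mono2)
    then show ?thesis using n by simp
  qed
  have "bij_betw ?f ?T ?P"
  proof (rule bij_betw_imageI)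
    show "inj_on ?f ?T"
    proof (rule inj_onI)
      fix u v assume uv: "u \<in> ?T" "v \<in> ?T" "?f u = ?f v"
      obtain Y Z b s d where u: "u = ((Y, Z), b, s, d)" by (cases u) auto
      obtain Y' Z' b' s' d' where v: "v = ((Y', Z'), b', s', d')" by (cases v) auto
      have eq: "root_poly Y * s = root_poly Y' * s'" "root_poly Z * d = root_poly Z' * d'" using uv u v by simp_all
      have nv: "poly s x \<noteq> 0" "poly d x \<noteq> 0" "poly s' x \<noteq> 0" "poly d' x \<noteq> 0" for x
        using uv(1,2) u v by (auto simp: nonvanishing_pairs_def)
      \<comment> \<open>The root-free cofactors add no zeros, so the products remember
        \<open>Y\<close> and \<open>Z\<close>.\<close>
      have "Y = {x. poly (root_poly Y * s) x = 0}" "Y' = {x. poly (root_poly Y' * s') x = 0}"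
        "Z = {x. poly (root_poly Z * d) x = 0}" "Z' = {x. poly (root_poly Z' * d') x = 0}"
        using nv by (auto simp: poly_root_poly_eq_0_iff)
      then have YZ: "Y = Y'" "Z = Z'" using eq by metis+
      then have sd: "s = s'" "d = d'" using eq by (simp_all add: root_poly_nonzero)
      have "b x = poly s x * (poly d x)\<^sup>2" "b' x = poly s' x * (poly d' x)\<^sup>2" for x
        using uv(1,2) u v by auto
      then have "b = b'" using sd by auto
      then show "u = v" using u v YZ sd by simp
    qed
    show "?f ` ?T = ?P"
    proof (intro set_eqI iffI)
      fix p assume "p \<in> ?f ` ?T"
      then obtain Y Z b s d where *: "p = (root_poly Y * s, root_poly Z * d)"
        "(Y, Z) \<in> zero_patterns a" "b \<in> cofactor_values a Y Z"
        "(s, d) \<in> nonvanishing_pairs N (n - (card Y + N * card Z))"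
        "\<And>x. poly s x * (poly d x)\<^sup>2 = b x" by auto
      have sd: "lead_coeff s = 1" "squarefree s" "lead_coeff d = 1" "squarefree d"
        "degree s + N * degree d = n - (card Y + N * card Z)" "\<And>x. poly s x \<noteq> 0" "\<And>x. poly d x \<noteq> 0"
        using *(4) by (simp_all add: nonvanishing_pairs_def squarefree_pairs_def)
      have nz: "s \<noteq> 0" "d \<noteq> 0" using sd by auto
      have deg: "degree (root_poly Y * s) = card Y + degree s" "degree (root_poly Z * d) = card Z + degree d"
        using nz by (simp_all add: degree_mult_eq root_poly_nonzero degree_root_poly)
      have "degree (root_poly Y * s) + N * degree (root_poly Z * d) = n"
        unfolding deg using sd(5) bound[of Y Z] by (simp add: algebra_simps)
      moreover have "squarefree (root_poly Y * s)" "squarefree (root_poly Z * d)"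
        using sd by (simp_all add: squarefree_root_poly_mult)
      moreover have "lead_coeff (root_poly Y * s) = 1" "lead_coeff (root_poly Z * d) = 1"
        unfolding lead_coeff_mult lead_coeff_root_poly using sd by simp_all
      ultimately have "p \<in> squarefree_pairs N n" using *(1) by (simp add: squarefree_pairs_def)
      moreover have "poly (root_poly Y * s) x * (poly (root_poly Z * d) x)\<^sup>2 = a x" for x
      proof -
        have "poly (root_poly Y * s) x * (poly (root_poly Z * d) x)\<^sup>2 =
            poly (root_poly Y) x * (poly (root_poly Z) x)\<^sup>2 * b x"
          by (simp add: *(5)[symmetric] power_mult_distrib mult_ac)
        also have "\<dots> = a x" using *(3) by (simp add: cofactor_values_def)
        finally show ?thesis .
      qed
      ultimately show "p \<in> ?P" using *(1) by simp
    next
      fix p assume "p \<in> ?P"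
      then obtain A B where *: "p = (A, B)" "(A, B) \<in> squarefree_pairs N n"
        "\<And>x. poly A x * (poly B x)\<^sup>2 = a x" by auto
      have AB: "lead_coeff A = 1" "squarefree A" "lead_coeff B = 1" "squarefree B" "degree A + N * degree B = n"
        using *(2) by (simp_all add: squarefree_pairs_def)
      define Y Z where "Y = {x. poly A x = 0}" and "Z = {x. poly B x = 0}"
      obtain s where s: "lead_coeff s = 1" "squarefree s" "\<And>x. poly s x \<noteq> 0" "A = root_poly Y * s"
        "degree A = card Y + degree s"
        using squarefree_root_poly_decomposition[OF AB(1,2)] unfolding Y_def by metis
      obtain d where d: "lead_coeff d = 1" "squarefree d" "\<And>x. poly d x \<noteq> 0" "B = root_poly Z * d"
        "degree B = card Z + degree d"
        using squarefree_root_poly_decomposition[OF AB(3,4)] unfolding Z_def by metis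
      define b where "b x = poly s x * (poly d x)\<^sup>2" for x
      have "Y \<union> Z = {x. a x = 0}" unfolding Y_def Z_def by (auto simp: *(3)[symmetric])
      then have "(Y, Z) \<in> zero_patterns a" by (simp add: zero_patterns_def)
      moreover have "b \<in> cofactor_values a Y Z"
        using s(3) d(3) by (simp add: cofactor_values_def b_def *(3)[symmetric] s(4) d(4) power_mult_distrib mult_ac)
      moreover have "(s, d) \<in> ?S Y Z b"
        using s(1,2,3) d(1,2,3) AB(5) unfolding s(5) d(5)
        by (simp add: nonvanishing_pairs_def squarefree_pairs_def b_def algebra_simps)
      ultimately show "p \<in> ?f ` ?T"
        by (intro image_eqI[of _ _ "((Y, Z), b, s, d)"]) (simp_all add: *(1) s(4) d(4))
    qed
  qed
  then have "card ?P = card ?T" by (simp add: bij_betw_same_card)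
  also have "\<dots> = (\<Sum>(Y, Z)\<in>zero_patterns a. \<Sum>b\<in>cofactor_values a Y Z. card (?S Y Z b))"
  proof -
    have fin: "finite (?S Y Z b)" for Y Z b
      by (rule finite_subset[OF _ finite_squarefree_pairs[OF N]]) (auto simp: nonvanishing_pairs_def)
    have fin2: "finite (SIGMA b:cofactor_values a Y Z. ?S Y Z b)" for Y Z
      using fin by (intro finite_SigmaI) auto
    have "card (SIGMA b:cofactor_values a Y Z. ?S Y Z b) = (\<Sum>b\<in>cofactor_values a Y Z. card (?S Y Z b))" for Y Z
      using fin by (intro card_SigmaI) auto
    then show ?thesis using fin2
      by (subst card_SigmaI) (auto simp: split_beta intro!: sum.cong)
  qed
  finally show ?thesis by (simp add: pair_count_def)
qed

text \<open>Each zero of \<open>a\<close> lies in \<open>Y\<close> only, in \<open>Z\<close> only or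
  in both, independently of the others, with weight \<open>y\<close>, \<open>z\<close> or
  \<open>y * z\<close>. The three images in the induction step are these three choices for the new
  point.\<close>

lemma sum_zero_patterns:
  fixes a :: "'a::{field,finite} \<Rightarrow> 'a" and y z :: real
  shows "(\<Sum>(Y, Z)\<in>zero_patterns a. y ^ card Y * z ^ card Z) = (y + z + y * z) ^ card {x. a x = 0}"
proof -
  have *: "(\<Sum>(Y, Z)\<in>{(Y, Z). Y \<union> Z = W}. y ^ card Y * z ^ card Z) = (y + z + y * z) ^ card W"
    if "finite W" for W :: "'a set"
    using that
  proof (induction W)
    case empty
    have "{(Y, Z). Y \<union> Z = ({} :: 'a set)} = {({}, {})}" by auto
    then show ?case by simp
  next
    case (insert w W)
    let ?A = "{(Y, Z). Y \<union> Z = W}" and ?h = "\<lambda>(Y, Z). y ^ card Y * z ^ card (Z :: 'a set)"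
    let ?i = "\<lambda>(Y, Z). (insert w Y, Z)" and ?j = "\<lambda>(Y, Z). (Y, insert w Z)"
      and ?k = "\<lambda>(Y, Z). (insert w Y, insert w Z)"
    have finA: "finite ?A" by simp
    have nw: "w \<notin> Y" "w \<notin> Z" if "(Y, Z) \<in> ?A" for Y Z using that insert by auto
    have ci: "card (insert w Y) = Suc (card Y)" if "Y \<subseteq> W" for Y
      using that insert.hyps by (metis card_insert_disjoint rev_finite_subset subsetD)
    have inj: "inj_on ?i ?A" "inj_on ?j ?A" "inj_on ?k ?A"
      unfolding inj_on_def using insert.hyps by (auto simp: insert_eq_iff)
    have "{(Y, Z). Y \<union> Z = insert w W} = ?i ` ?A \<union> ?j ` ?A \<union> ?k ` ?A"
    proof (intro set_eqI iffI)
      fix p assume "p \<in> {(Y, Z). Y \<union> Z = insert w W}"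
      then obtain Y Z where p: "p = (Y, Z)" "Y \<union> Z = insert w W" by auto
      have *: "(Y - {w}, Z - {w}) \<in> ?A" using p insert by auto
      consider "w \<in> Y" "w \<in> Z" | "w \<in> Y" "w \<notin> Z" | "w \<notin> Y" "w \<in> Z" using p by auto
      then show "p \<in> ?i ` ?A \<union> ?j ` ?A \<union> ?k ` ?A"
      proof cases
        case 1
        then have "p = ?k (Y - {w}, Z - {w})" using p by auto
        then show ?thesis using * by blast
      next
        case 2
        then have "p = ?i (Y - {w}, Z - {w})" using p by auto
        then show ?thesis using * by blast
      next
        case 3
        then have "p = ?j (Y - {w}, Z - {w})" using p by auto
        then show ?thesis using * by blast
      qed
    qed auto
    moreover have "?i ` ?A \<inter> ?j ` ?A = {}" "(?i ` ?A \<union> ?j ` ?A) \<inter> ?k ` ?A = {}"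
      using nw by auto
    ultimately have "sum ?h {(Y, Z). Y \<union> Z = insert w W} = sum ?h (?i ` ?A) + sum ?h (?j ` ?A) + sum ?h (?k ` ?A)"
      by (simp add: sum.union_disjoint)
    also have "\<dots> = sum (?h \<circ> ?i) ?A + sum (?h \<circ> ?j) ?A + sum (?h \<circ> ?k) ?A"
      by (simp only: sum.reindex[OF inj(1)] sum.reindex[OF inj(2)] sum.reindex[OF inj(3)])
    also have "\<dots> = y * sum ?h ?A + z * sum ?h ?A + y * z * sum ?h ?A"
      unfolding sum_distrib_left
      by (intro arg_cong2[of _ _ _ _ "(+)"] sum.cong refl) (auto simp: ci)
    also have "\<dots> = (y + z + y * z) * sum ?h ?A" by (simp add: algebra_simps)
    finally show ?case using insert by simp
  qed
  show ?thesis unfolding zero_patterns_def by (rule *) simp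
qed

subsection \<open>Asymptotics of the counts\<close>

lemma CARD_field_ge_2: "2 \<le> CARD('a::{field,finite})"
proof -
  have "card {0, 1 :: 'a} \<le> CARD('a)" by (intro card_mono) auto
  then show ?thesis by simp
qed

text \<open>At \<open>a = Suc m\<close> the sum is empty and the right side vanishes; the induction
  enters there.\<close>

lemma sum_half_powers:
  "a \<le> Suc m \<Longrightarrow> (\<Sum>j=a..m. (1 / 2 :: real) ^ j) = 2 * (1 / 2) ^ a - (1 / 2) ^ m"
proof (induction m)
  case 0
  then have "a = 0 \<or> a = 1" by auto
  then show ?case by auto
next
  case (Suc m)
  show ?case
  proof (cases "a = Suc (Suc m)")
    case False
    then have "a \<le> Suc m" using Suc.prems by simp
    then show ?thesis using Suc.IH by simp
  qed simp
qed

lemma sum_half_powers_le: "(\<Sum>j=a..m. (1 / 2 :: real) ^ j) \<le> 2 * (1 / 2) ^ a"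
proof (cases "a \<le> Suc m")
  case True
  then show ?thesis by (simp add: sum_half_powers)
qed simp

text \<open>An eventual bound x improves to 3x/4. The weights sum to at most 1/2, so indices j up to
  a cutoff contribute at most x/2; the remaining j, for which n - 2j may be too small for the bound
  x, contribute at most x/8, and so does the vanishing term. Iteration from a global bound gives
  convergence to 0.\<close>

lemma contracting_recursion_tendsto_0:
  fixes E \<tau> :: "nat \<Rightarrow> real"
  assumes nonneg: "\<And>n. 0 \<le> E n" and bounded: "\<And>n. E n \<le> B"
    and \<tau>: "\<tau> \<longlonglongrightarrow> 0"
    and rec: "\<And>n. n \<ge> n0 \<Longrightarrow> E n \<le> \<tau> n + (\<Sum>j=2..n div 2. (1 / 2) ^ j * E (n - 2 * j))"
  shows "E \<longlonglongrightarrow> 0"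
proof -
  \<comment> \<open>Adding 1 makes the bound positive, so that it can be divided by.\<close>
  define C where "C = B + 1"
  have C: "C > 0" "E n \<le> C" for n
    using nonneg[of n] bounded[of n] by (auto simp: C_def)
  have step: "eventually (\<lambda>n. E n \<le> 3 / 4 * x) sequentially"
    if x: "x > 0" "eventually (\<lambda>n. E n \<le> x) sequentially" for x
  proof -
    obtain n1 where n1: "\<And>n. n \<ge> n1 \<Longrightarrow> E n \<le> x"
      using x(2) by (auto simp: eventually_sequentially)
    \<comment> \<open>The cutoff J makes the geometric tail beyond it, times the global bound C, at
      most x/8.\<close>
    have "0 < x / 8 / C" using x(1) C(1) by simp
    then obtain J where "(1 / 2) ^ J < x / 8 / C"
      using real_arch_pow_inv[of "x / 8 / C" "1 / 2"] by auto
    then have J: "C * (1 / 2) ^ J \<le> x / 8" using C(1) by (simp add: field_simps)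
    have "eventually (\<lambda>n. \<tau> n < x / 8) sequentially"
      using \<tau> x(1) by (intro order_tendstoD(2)) auto
    moreover have "eventually (\<lambda>n. n \<ge> max n0 (n1 + 2 * J)) sequentially"
      by (rule eventually_ge_at_top)
    ultimately show ?thesis
    proof eventually_elim
      case (elim n)
      let ?m = "n div 2"
      have "(\<Sum>j=2..?m. (1 / 2) ^ j * E (n - 2 * j)) \<le>
          (\<Sum>j=2..?m. (1 / 2) ^ j * x + (if J < j then C * (1 / 2) ^ j else 0))"
      proof (rule sum_mono)
        fix j assume "j \<in> {2..?m}"
        show "(1 / 2) ^ j * E (n - 2 * j) \<le> (1 / 2) ^ j * x + (if J < j then C * (1 / 2) ^ j else 0)"
        proof (cases "J < j")
          case True
          have "(1 / 2) ^ j * E (n - 2 * j) \<le> (1 / 2) ^ j * C" by (intro mult_left_mono C(2)) simp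
          then show ?thesis using True x(1) by (simp add: mult.commute add.commute add_increasing2)
        next
          case False
          moreover have "n1 + 2 * J \<le> n" using elim(2) by simp
          ultimately have "n1 \<le> n - 2 * j" by linarith
          then show ?thesis using False n1 by (simp add: mult_left_mono)
        qed
      qed
      also have "\<dots> = x * (\<Sum>j=2..?m. (1 / 2) ^ j) + C * (\<Sum>j\<in>{2..?m} \<inter> {j. J < j}. (1 / 2) ^ j)"
        by (simp add: sum.distrib sum_distrib_left mult.commute sum.If_cases)
      also have "(\<Sum>j=2..?m. (1 / 2 :: real) ^ j) \<le> 1 / 2"
        using sum_half_powers_le[of 2 ?m] by (simp add: power2_eq_square)
      also have "(\<Sum>j\<in>{2..?m} \<inter> {j. J < j}. (1 / 2 :: real) ^ j) \<le> (\<Sum>j=Suc J..?m. (1 / 2) ^ j)"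
        by (intro sum_mono2) auto
      also have "\<dots> \<le> (1 / 2) ^ J" using sum_half_powers_le[of "Suc J" ?m] by simp
      finally have "(\<Sum>j=2..?m. (1 / 2) ^ j * E (n - 2 * j)) \<le> x * (1 / 2) + C * (1 / 2) ^ J"
        using x(1) C(1) by simp
      then show "E n \<le> 3 / 4 * x" using rec[of n] elim J by simp
    qed
  qed
  have geo: "eventually (\<lambda>n. E n \<le> (3 / 4) ^ k * C) sequentially" for k
  proof (induction k)
    case 0
    then show ?case using C(2) by simp
  next
    case (Suc k)
    then show ?case using step[of "(3 / 4) ^ k * C"] C(1) by (simp add: mult.assoc)
  qed
  show ?thesis
  proof (rule order_tendstoI)
    fix e :: real assume "e < 0"
    then show "eventually (\<lambda>n. e < E n) sequentially"
      by (intro always_eventually allI) (use nonneg in \<open>auto intro: less_le_trans\<close>)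
  next
    fix e :: real assume e: "0 < e"
    then have "0 < e / C" using C(1) by simp
    then obtain k where "(3 / 4) ^ k < e / C"
      using real_arch_pow_inv[of "e / C" "3 / 4"] by auto
    then have "(3 / 4) ^ k * C < e" using C(1) by (simp add: field_simps)
    show "eventually (\<lambda>n. E n < e) sequentially"
      by (rule eventually_mono[OF geo[of k]]) (use \<open>(3 / 4) ^ k * C < e\<close> in linarith)
  qed
qed

lemma inverse_card_power_le: "1 / real CARD('a::{field,finite}) ^ j \<le> (1 / 2) ^ j"
proof -
  have "(2::real) ^ j \<le> real CARD('a) ^ j"
    using CARD_field_ge_2[where 'a = 'a] by (intro power_mono) auto
  then show ?thesis by (simp add: power_divide frac_le)
qed

lemma summable_half_powers: "summable (\<lambda>j. (1 / 2 :: real) ^ j)"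
  by (rule summable_geometric) simp

lemma suminf_pos_of_first:
  fixes g :: "nat \<Rightarrow> real"
  assumes "summable g" "\<And>j. 0 \<le> g j" "g 0 > 0"
  shows "suminf g > 0"
  using assms by (intro suminf_pos2[of g 0])

text \<open>
  The relation \<open>sum_squarefree_count\<close>, divided by \<open>q\<^sup>n\<close>, says that an average of the
  normalized counts is constant. The terms with \<open>d \<noteq> 1\<close> have \<open>deg d \<ge> 2\<close>, because linear
  polynomials have a root, and their total weight is at most \<open>1/2\<close>.
\<close>

lemma squarefree_count_limit:
  "\<exists>L>0. \<forall>a :: 'a::{field,finite} \<Rightarrow> 'a. (\<forall>x. a x \<noteq> 0) \<longrightarrow>
    (\<lambda>n. real (squarefree_count n a) / real CARD('a) ^ n) \<longlonglongrightarrow> L"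
proof -
  define q where "q = real CARD('a)"
  have q: "q \<ge> 2" using CARD_field_ge_2[where 'a = 'a] by (simp add: q_def)
  define v where "v j = card (nonvanishing_polys j :: 'a poly set)" for j
  define g where "g j = real (v j) / q ^ (2 * j)" for j
  have v_le: "real (v j) \<le> q ^ j" for j
    using card_nonvanishing_polys_le[of j, where 'a = 'a] unfolding v_def q_def
    by (metis of_nat_le_iff of_nat_power)
  have g_nonneg: "0 \<le> g j" for j using q by (simp add: g_def)
  have g_le: "g j \<le> (1 / 2) ^ j" for j
  proof -
    have "g j \<le> q ^ j / q ^ (2 * j)" unfolding g_def using v_le q by (intro divide_right_mono) auto
    also have "\<dots> = 1 / q ^ j" using q by (simp add: mult_2 power_add)
    also have "\<dots> \<le> (1 / 2) ^ j" unfolding q_def by (rule inverse_card_power_le)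
    finally show ?thesis .
  qed
  have summable: "summable g"
    by (rule summable_comparison_test'[OF summable_half_powers]) (use g_le g_nonneg in auto)
  have g0: "g 0 = 1" by (simp add: g_def v_def nonvanishing_polys_0)
  define C where "C = suminf g"
  have C: "C > 0" unfolding C_def using summable g_nonneg g0 by (intro suminf_pos_of_first) auto
  \<comment> \<open>The only possible limit: if all normalized counts tend to L, the averaged
    identity becomes \<open>1 / q^q = L * suminf g\<close>.\<close>
  define L where "L = 1 / (q ^ CARD('a) * C)"
  have L: "L > 0" using q C by (simp add: L_def)
  define G :: "('a \<Rightarrow> 'a) set" where "G = {a. \<forall>x. a x \<noteq> 0}"
  have G1: "(\<lambda>x. 1) \<in> G" by (simp add: G_def)
  define w where "w n a = real (squarefree_count n a) / q ^ n" for n and a :: "'a \<Rightarrow> 'a"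
  have w: "0 \<le> w n a" "w n a \<le> 1" for n a
  proof -
    show "0 \<le> w n a" using q by (simp add: w_def)
    have "real (squarefree_count n a) \<le> q ^ n"
      using squarefree_count_le[of n a] unfolding q_def by (metis of_nat_le_iff of_nat_power)
    then show "w n a \<le> 1" using q by (simp add: w_def)
  qed
  \<comment> \<open>The recursion passes from \<open>a\<close> to \<open>a / d^2\<close>, so the
    error is taken uniformly over the finite set of nonvanishing functions, which is closed under
    this change.\<close>
  define E where "E n = Max ((\<lambda>a. \<bar>w n a - L\<bar>) ` G)" for n
  have E_ge: "\<bar>w n a - L\<bar> \<le> E n" if "a \<in> G" for n a
    unfolding E_def using that by (intro Max_ge) auto
  have E_obtain: "\<exists>a\<in>G. E n = \<bar>w n a - L\<bar>" for n
  proof -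
    have "E n \<in> (\<lambda>a. \<bar>w n a - L\<bar>) ` G" unfolding E_def using G1 by (intro Max_in) auto
    then show ?thesis by auto
  qed
  \<comment> \<open>The defect of the averaged identity when every normalized count is replaced by
    L; it vanishes in the limit by the choice of L.\<close>
  define \<tau> where "\<tau> n = \<bar>1 / q ^ CARD('a) - L * (\<Sum>j\<le>n div 2. g j)\<bar>" for n
  have "(\<lambda>n. \<Sum>j\<le>n. g j) \<longlonglongrightarrow> C" unfolding C_def by (rule summable_LIMSEQ'[OF summable])
  moreover have "filterlim (\<lambda>n::nat. n div 2) sequentially sequentially"
    by (auto simp: filterlim_at_top eventually_sequentially) (metis div_le_mono nonzero_mult_div_cancel_left zero_neq_numeral)
  ultimately have "(\<lambda>n. \<Sum>j\<le>n div 2. g j) \<longlonglongrightarrow> C" by (rule filterlim_compose)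
  then have "\<tau> \<longlonglongrightarrow> \<bar>1 / q ^ CARD('a) - L * C\<bar>" unfolding \<tau>_def by (intro tendsto_intros)
  moreover have "1 / q ^ CARD('a) - L * C = 0" using C q by (simp add: L_def)
  ultimately have \<tau>: "\<tau> \<longlonglongrightarrow> 0" by simp
  have E_lim: "E \<longlonglongrightarrow> 0"
  proof (rule contracting_recursion_tendsto_0[OF _ _ \<tau>])
    show "0 \<le> E n" for n using E_obtain[of n] by auto
    show "E n \<le> 1 + L" for n
    proof -
      obtain a where "E n = \<bar>w n a - L\<bar>" using E_obtain[of n] by blast
      then show ?thesis using w[of n a] L by linarith
    qed
    fix n assume n: "n \<ge> CARD('a)"
    obtain a where a: "a \<in> G" "E n = \<bar>w n a - L\<bar>" using E_obtain by blast
    have aG: "(\<lambda>x. a x / (poly d x)\<^sup>2) \<in> G" if "d \<in> nonvanishing_polys j" for d :: "'a poly" and j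
      using that a(1) by (simp add: G_def nonvanishing_polys_def)
    define h where "h j = (\<Sum>d\<in>nonvanishing_polys j. (w (n - 2 * j) (\<lambda>x. a x / (poly d x)\<^sup>2) - L) / q ^ (2 * j))" for j
    have "real (CARD('a) ^ (n - CARD('a))) = (\<Sum>j\<le>n div 2. \<Sum>d\<in>nonvanishing_polys j.
        real (squarefree_count (n - 2 * j) (\<lambda>x. a x / (poly d x)\<^sup>2)))"
      by (subst sum_squarefree_count[OF _ n, of a]) (use a(1) in \<open>simp_all add: G_def\<close>)
    then have "real (CARD('a) ^ (n - CARD('a))) / q ^ n = (\<Sum>j\<le>n div 2. \<Sum>d\<in>nonvanishing_polys j.
        real (squarefree_count (n - 2 * j) (\<lambda>x. a x / (poly d x)\<^sup>2)) / q ^ n)"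
      by (simp add: sum_divide_distrib)
    also have "real (CARD('a) ^ (n - CARD('a))) / q ^ n = 1 / q ^ CARD('a)"
    proof -
      have "q ^ n = q ^ (n - CARD('a)) * q ^ CARD('a)" using n by (metis le_add_diff_inverse2 power_add)
      then show ?thesis using q by (simp add: q_def)
    qed
    also have "(\<Sum>j\<le>n div 2. \<Sum>d\<in>nonvanishing_polys j.
          real (squarefree_count (n - 2 * j) (\<lambda>x. a x / (poly d x)\<^sup>2)) / q ^ n) =
        (\<Sum>j\<le>n div 2. \<Sum>d\<in>nonvanishing_polys j. w (n - 2 * j) (\<lambda>x. a x / (poly d x)\<^sup>2) / q ^ (2 * j))"
    proof (intro sum.cong refl)
      fix j assume "j \<in> {..n div 2}"
      then have "2 * j \<le> n" by auto
      then have "q ^ n = q ^ (n - 2 * j) * q ^ (2 * j)" by (metis le_add_diff_inverse2 power_add)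
      then show "real (squarefree_count (n - 2 * j) (\<lambda>x. a x / (poly d x)\<^sup>2)) / q ^ n =
          w (n - 2 * j) (\<lambda>x. a x / (poly d x)\<^sup>2) / q ^ (2 * j)" for d
        by (simp add: w_def)
    qed
    finally have "1 / q ^ CARD('a) - L * (\<Sum>j\<le>n div 2. g j) = (\<Sum>j\<le>n div 2. h j)"
      by (simp add: h_def g_def v_def sum_subtractf diff_divide_distrib sum_distrib_left mult.commute)
    \<comment> \<open>Since n is at least q and q at least 2, the index 1 occurs. The index 0 has
      only \<open>d = 1\<close> and isolates \<open>w n a - L\<close>; the index 1 contributes
      nothing.\<close>
    moreover have "{..n div 2} = insert 0 (insert 1 {2..n div 2})"
      using n CARD_field_ge_2[where 'a = 'a] by auto
    moreover have "h 0 = w n a - L" "h 1 = 0"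
      by (simp_all add: h_def nonvanishing_polys_0 nonvanishing_polys_1)
    ultimately have "w n a - L = (1 / q ^ CARD('a) - L * (\<Sum>j\<le>n div 2. g j)) - (\<Sum>j=2..n div 2. h j)"
      by simp
    then have "E n \<le> \<tau> n + \<bar>\<Sum>j=2..n div 2. h j\<bar>" unfolding a(2) \<tau>_def by linarith
    also have "\<bar>\<Sum>j=2..n div 2. h j\<bar> \<le> (\<Sum>j=2..n div 2. (1 / 2) ^ j * E (n - 2 * j))"
    proof (rule order_trans[OF sum_abs], rule sum_mono)
      fix j
      have "\<bar>h j\<bar> \<le> (\<Sum>d\<in>nonvanishing_polys j. \<bar>(w (n - 2 * j) (\<lambda>x. a x / (poly d x)\<^sup>2) - L) / q ^ (2 * j)\<bar>)"
        unfolding h_def by (rule sum_abs)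
      also have "\<dots> \<le> (\<Sum>d\<in>(nonvanishing_polys j :: 'a poly set). E (n - 2 * j) / q ^ (2 * j))"
        using q by (intro sum_mono) (auto simp: abs_divide intro!: divide_right_mono E_ge aG)
      also have "\<dots> = g j * E (n - 2 * j)" by (simp add: g_def v_def)
      also have "\<dots> \<le> (1 / 2) ^ j * E (n - 2 * j)"
        using E_obtain[of "n - 2 * j"] by (intro mult_right_mono g_le) auto
      finally show "\<bar>h j\<bar> \<le> (1 / 2) ^ j * E (n - 2 * j)" .
    qed
    finally show "E n \<le> \<tau> n + (\<Sum>j=2..n div 2. (1 / 2) ^ j * E (n - 2 * j))" by simp
  qed
  have "(\<lambda>n. w n a) \<longlonglongrightarrow> L" if "a \<in> G" for a
  proof -
    have "eventually (\<lambda>n. norm (w n a - L) \<le> E n) sequentially"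
      using E_ge[OF that] by (intro always_eventually) simp
    then have "(\<lambda>n. w n a - L) \<longlonglongrightarrow> 0" using E_lim by (rule Lim_null_comparison)
    then show ?thesis by (rule LIM_zero_cancel)
  qed
  then show ?thesis using L unfolding w_def q_def G_def by auto
qed

text \<open>For fixed degree j of \<open>d\<close>, the normalized contribution tends to
  \<open>g j * L\<close>, with L the same for every nonvanishing function. This is why the limit
  does not depend on \<open>a\<close>.\<close>

lemma pair_count_limit:
  assumes N: "N \<ge> 2"
  shows "\<exists>K>0. \<forall>a :: 'a::{field,finite} \<Rightarrow> 'a. (\<forall>x. a x \<noteq> 0) \<longrightarrow>
    (\<lambda>n. real (pair_count N n a) / real CARD('a) ^ n) \<longlonglongrightarrow> K"
proof -
  define q where "q = real CARD('a)"
  have q: "q \<ge> 2" using CARD_field_ge_2[where 'a = 'a] by (simp add: q_def)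
  obtain L where L: "L > 0" "\<And>a :: 'a \<Rightarrow> 'a. (\<And>x. a x \<noteq> 0) \<Longrightarrow>
      (\<lambda>n. real (squarefree_count n a) / q ^ n) \<longlonglongrightarrow> L"
    using squarefree_count_limit[where 'a = 'a] unfolding q_def by blast
  define v where "v j = card (squarefree_nonvanishing j :: 'a poly set)" for j
  define g where "g j = real (v j) / q ^ (N * j)" for j
  have g_nonneg: "0 \<le> g j" for j using q by (simp add: g_def)
  have g_le: "g j \<le> (1 / 2) ^ j" for j
  proof -
    have "real (v j) \<le> q ^ j"
      using card_squarefree_nonvanishing_le[of j, where 'a = 'a] unfolding v_def q_def
      by (metis of_nat_le_iff of_nat_power)
    \<comment> \<open>Here \<open>N >= 2\<close> enters: q^j choices of \<open>d\<close> against a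
      cost of at least q^(2j) leave a geometric majorant.\<close>
    moreover have "q ^ (2 * j) \<le> q ^ (N * j)" using q N by (intro power_increasing) auto
    ultimately have "g j \<le> q ^ j / q ^ (2 * j)" unfolding g_def using q by (intro frac_le) auto
    also have "\<dots> = 1 / q ^ j" using q by (simp add: mult_2 power_add)
    also have "\<dots> \<le> (1 / 2) ^ j" unfolding q_def by (rule inverse_card_power_le)
    finally show ?thesis .
  qed
  have summable: "summable g"
    by (rule summable_comparison_test'[OF summable_half_powers]) (use g_le g_nonneg in auto)
  have "squarefree_nonvanishing 0 = {1 :: 'a poly}"
    by (auto simp: squarefree_nonvanishing_def nonvanishing_polys_0)
  then have "g 0 = 1" by (simp add: g_def v_def)
  then have C: "suminf g > 0" using summable g_nonneg by (intro suminf_pos_of_first) auto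
  have "(\<lambda>n. real (pair_count N n a) / q ^ n) \<longlonglongrightarrow> suminf g * L" if a: "\<And>x. a x \<noteq> 0" for a :: "'a \<Rightarrow> 'a"
  proof -
    \<comment> \<open>Extension by 0 beyond \<open>n div N\<close> turns a sum whose range grows
      with n into a series with a dominated general term, the form required by Tannery's
      theorem.\<close>
    define f where "f j n = (if j \<le> n div N then \<Sum>d\<in>squarefree_nonvanishing j.
        real (squarefree_count (n - N * j) (\<lambda>x. a x / (poly d x)\<^sup>2)) / q ^ (n - N * j) / q ^ (N * j) else 0)" for j n
    have pc: "real (pair_count N n a) / q ^ n = (\<Sum>j. f j n)" for n
    proof -
      have "(\<Sum>j. f j n) = (\<Sum>j\<le>n div N. f j n)"
        by (rule suminf_finite) (auto simp: f_def)
      also have "\<dots> = (\<Sum>j\<le>n div N. \<Sum>d\<in>squarefree_nonvanishing j.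
          real (squarefree_count (n - N * j) (\<lambda>x. a x / (poly d x)\<^sup>2)) / q ^ n)"
      proof (rule sum.cong[OF refl])
        fix j assume j: "j \<in> {..n div N}"
        then have "N * j \<le> n" using N by (metis atMost_iff less_eq_div_iff_mult_less_eq mult.commute pos2 less_le_trans)
        then have "q ^ n = q ^ (n - N * j) * q ^ (N * j)" by (metis le_add_diff_inverse2 power_add)
        then show "f j n = (\<Sum>d\<in>squarefree_nonvanishing j.
            real (squarefree_count (n - N * j) (\<lambda>x. a x / (poly d x)\<^sup>2)) / q ^ n)"
          using j by (simp add: f_def)
      qed
      also have "\<dots> = real (pair_count N n a) / q ^ n"
        using N by (subst pair_count_eq) (simp_all add: sum_divide_distrib)
      finally show ?thesis by simp
    qed
    have lim: "(\<lambda>n. f j n) \<longlonglongrightarrow> g j * L" for j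
    proof -
      have "(\<lambda>n. real (squarefree_count (n - N * j) (\<lambda>x. a x / (poly d x)\<^sup>2)) / q ^ (n - N * j)) \<longlonglongrightarrow> L"
        if "d \<in> squarefree_nonvanishing j" for d :: "'a poly"
      proof -
        have "a x / (poly d x)\<^sup>2 \<noteq> 0" for x
          using a[of x] that by (simp add: squarefree_nonvanishing_def nonvanishing_polys_def)
        from filterlim_compose[OF L(2)[OF this] filterlim_minus_const_nat_at_top] show ?thesis .
      qed
      then have "(\<lambda>n. \<Sum>d\<in>squarefree_nonvanishing j.
          real (squarefree_count (n - N * j) (\<lambda>x. a x / (poly d x)\<^sup>2)) / q ^ (n - N * j) / q ^ (N * j))
          \<longlonglongrightarrow> (\<Sum>d\<in>(squarefree_nonvanishing j :: 'a poly set). L / q ^ (N * j))"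
        using q by (intro tendsto_sum tendsto_divide tendsto_const) auto
      moreover have "eventually (\<lambda>n. (\<Sum>d\<in>squarefree_nonvanishing j.
          real (squarefree_count (n - N * j) (\<lambda>x. a x / (poly d x)\<^sup>2)) / q ^ (n - N * j) / q ^ (N * j)) = f j n) sequentially"
        using eventually_ge_at_top[of "N * j"]
      proof eventually_elim
        case (elim n)
        then have "j \<le> n div N" using N by (simp add: less_eq_div_iff_mult_less_eq mult.commute)
        then show ?case by (simp add: f_def)
      qed
      ultimately have "(\<lambda>n. f j n) \<longlonglongrightarrow> (\<Sum>d\<in>(squarefree_nonvanishing j :: 'a poly set). L / q ^ (N * j))"
        by (rule Lim_transform_eventually)
      then show ?thesis by (simp add: g_def v_def)
    qed
    have bound: "norm (f j n) \<le> (1 / 2) ^ j" for j n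
    proof -
      have "norm (f j n) \<le> (\<Sum>d\<in>(squarefree_nonvanishing j :: 'a poly set). 1 / q ^ (N * j))"
      proof (cases "j \<le> n div N")
        case True
        have *: "real (squarefree_count (n - N * j) b) / q ^ (n - N * j) \<le> 1" for b :: "'a \<Rightarrow> 'a"
        proof -
          have "real (squarefree_count (n - N * j) b) \<le> q ^ (n - N * j)"
            using squarefree_count_le[of "n - N * j" b] unfolding q_def by (metis of_nat_le_iff of_nat_power)
          then show ?thesis using q by simp
        qed
        have "f j n \<le> (\<Sum>d\<in>(squarefree_nonvanishing j :: 'a poly set). 1 / q ^ (N * j))"
          unfolding f_def if_P[OF True] using q by (intro sum_mono divide_right_mono *) simp
        moreover have "0 \<le> f j n" using q by (auto simp: f_def intro!: sum_nonneg)
        ultimately show ?thesis by simp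
      next
        case False
        then show ?thesis using q by (auto simp: f_def intro!: sum_nonneg)
      qed
      also have "\<dots> = g j" by (simp add: g_def v_def)
      finally show ?thesis using g_le order_trans by blast
    qed
    have "(\<lambda>n. \<Sum>j. f j n) \<longlonglongrightarrow> (\<Sum>j. g j * L)"
    proof -
      have "eventually (\<lambda>(j, n). norm (f j n) \<le> (1 / 2) ^ j) (at_top \<times>\<^sub>F sequentially)"
        by (intro always_eventually) (use bound in auto)
      from tannerys_theorem[OF lim this summable_half_powers] show ?thesis by simp
    qed
    also have "(\<Sum>j. g j * L) = suminf g * L" by (rule suminf_mult2[symmetric, OF summable])
    finally show ?thesis unfolding pc .
  qed
  then show ?thesis using C L(1) unfolding q_def by (intro exI[of _ "suminf g * L"]) auto
qed

text \<open>Splitting off the roots shifts n by \<open>card Y + N * card Z\<close>, so each pattern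
  and each cofactor function contributes K divided by that power of q. Summing with
  \<open>y = 1 / q\<close> and \<open>z = 1 / q^N\<close> gives the power.\<close>

lemma squarefree_pairs_values_limit:
  assumes N: "N \<ge> 2"
  shows "\<exists>K>0. \<forall>a :: 'a::{field,finite} \<Rightarrow> 'a.
    (\<lambda>n. real (card {(s, d) \<in> squarefree_pairs N n. \<forall>x. poly s x * (poly d x)\<^sup>2 = a x}) / real CARD('a) ^ n)
      \<longlonglongrightarrow> K * (real (CARD('a) - 1) *
        (1 / real CARD('a) + 1 / real CARD('a) ^ N + 1 / real CARD('a) ^ (N + 1))) ^ card {x. a x = 0}"
proof -
  define q where "q = real CARD('a)"
  have q: "q \<ge> 2" using CARD_field_ge_2[where 'a = 'a] by (simp add: q_def)
  obtain K where K: "K > 0" "\<And>a :: 'a \<Rightarrow> 'a. (\<And>x. a x \<noteq> 0) \<Longrightarrow>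
      (\<lambda>n. real (pair_count N n a) / q ^ n) \<longlonglongrightarrow> K"
    using pair_count_limit[OF N, where 'a = 'a] unfolding q_def by blast
  have "(\<lambda>n. real (card {(s, d) \<in> squarefree_pairs N n. \<forall>x. poly s x * (poly d x)\<^sup>2 = a x}) / q ^ n)
      \<longlonglongrightarrow> K * (real (CARD('a) - 1) * (1 / q + 1 / q ^ N + 1 / q ^ (N + 1))) ^ card {x. a x = 0}"
    for a :: "'a \<Rightarrow> 'a"
  proof -
    let ?m = "\<lambda>(Y :: 'a set) (Z :: 'a set). card Y + N * card Z"
    have lim: "(\<lambda>n. real (pair_count N (n - m) b) / q ^ n) \<longlonglongrightarrow> K / q ^ m"
      if "\<And>x. b x \<noteq> 0" for m and b :: "'a \<Rightarrow> 'a"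
    proof -
      have "(\<lambda>n. real (pair_count N (n - m) b) / q ^ (n - m)) \<longlonglongrightarrow> K"
        by (rule filterlim_compose[OF K(2)[OF that] filterlim_minus_const_nat_at_top])
      then have "(\<lambda>n. real (pair_count N (n - m) b) / q ^ (n - m) / q ^ m) \<longlonglongrightarrow> K / q ^ m"
        using q by (intro tendsto_divide tendsto_const) auto
      moreover have "eventually (\<lambda>n. real (pair_count N (n - m) b) / q ^ (n - m) / q ^ m =
          real (pair_count N (n - m) b) / q ^ n) sequentially"
        using eventually_ge_at_top[of m]
      proof eventually_elim
        case (elim n)
        then have "q ^ n = q ^ (n - m) * q ^ m" by (metis le_add_diff_inverse2 power_add)
        then show ?case by simp
      qed
      ultimately show ?thesis by (rule Lim_transform_eventually)
    qed
    have "(\<lambda>n. \<Sum>(Y, Z)\<in>zero_patterns a. \<Sum>b\<in>cofactor_values a Y Z. real (pair_count N (n - ?m Y Z) b) / q ^ n)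
        \<longlonglongrightarrow> (\<Sum>(Y, Z)\<in>zero_patterns a. \<Sum>b\<in>cofactor_values a Y Z. K / q ^ ?m Y Z)"
      unfolding split_beta
      by (intro tendsto_sum lim) (auto simp: cofactor_values_def)
    moreover have "eventually (\<lambda>n.
        real (card {(s, d) \<in> squarefree_pairs N n. \<forall>x. poly s x * (poly d x)\<^sup>2 = a x}) / q ^ n =
        (\<Sum>(Y, Z)\<in>zero_patterns a. \<Sum>b\<in>cofactor_values a Y Z. real (pair_count N (n - ?m Y Z) b) / q ^ n)) sequentially"
      (is "eventually (\<lambda>n. ?l n = ?r n) sequentially")
      using eventually_ge_at_top[of "(1 + N) * CARD('a)"]
    proof eventually_elim
      case (elim n)
      then show ?case using N
        by (subst card_squarefree_pairs_values) (auto simp: sum_divide_distrib split_beta)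
    qed
    moreover have "(\<Sum>(Y, Z)\<in>zero_patterns a. \<Sum>b\<in>cofactor_values a Y Z. K / q ^ ?m Y Z) =
        K * (real (CARD('a) - 1) * (1 / q + 1 / q ^ N + 1 / q ^ (N + 1))) ^ card {x. a x = 0}"
    proof -
      have "(\<Sum>(Y, Z)\<in>zero_patterns a. \<Sum>b\<in>cofactor_values a Y Z. K / q ^ ?m Y Z) =
          (\<Sum>(Y, Z)\<in>zero_patterns a. K * real (CARD('a) - 1) ^ card {x. a x = 0} *
            ((1 / q) ^ card Y * (1 / q ^ N) ^ card Z))"
      proof (intro sum.cong refl, clarsimp simp del: of_nat_diff)
        fix Y Z assume "(Y, Z) \<in> zero_patterns a"
        then show "real (card (cofactor_values a Y Z)) * K / q ^ ?m Y Z =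
            K * real (CARD('a) - Suc 0) ^ card {x. a x = 0} * ((1 / q) ^ card Y * (1 / q ^ N) ^ card Z)"
          by (simp add: card_cofactor_values power_add power_mult power_divide)
      qed
      also have "\<dots> = K * real (CARD('a) - 1) ^ card {x. a x = 0} *
          (\<Sum>(Y, Z)\<in>zero_patterns a. (1 / q) ^ card Y * (1 / q ^ N) ^ card Z)"
        by (simp add: sum_distrib_left split_beta mult.assoc)
      also have "\<dots> = K * (real (CARD('a) - 1) * (1 / q + 1 / q ^ N + 1 / q ^ (N + 1))) ^ card {x. a x = 0}"
        unfolding sum_zero_patterns by (simp only: power_mult_distrib mult.assoc power_add power_one_right)
            (simp add: divide_inverse mult_ac)
      finally show ?thesis .
    qed
    ultimately show ?thesis by (simp only: tendsto_cong)
  qed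
  then show ?thesis using K(1) unfolding q_def by blast
qed

subsection \<open>Fibres of the curve\<close>

definition root_count :: "nat \<Rightarrow> 'a::field \<Rightarrow> nat" where
  "root_count m v = card {y. y ^ m = v}"

lemma card_curve_points:
  "card (curve_points m (f :: 'a::{field,finite} poly)) = (\<Sum>x\<in>UNIV. root_count m (poly f x))"
proof -
  have "curve_points m f = (SIGMA x:UNIV. {y. y ^ m = poly f x})"
    by (auto simp: curve_points_def)
  then show ?thesis by (simp add: card_SigmaI root_count_def)
qed

text \<open>Multiplication by \<open>x\<close> permutes the nonzero elements, so it leaves their
  product unchanged.\<close>

lemma power_card_minus_1:
  fixes x :: "'a::{field,finite}"
  assumes "x \<noteq> 0"
  shows "x ^ (CARD('a) - 1) = 1"
proof -
  have "x ^ (CARD('a) - 1) * \<Prod>(UNIV - {0}) = (\<Prod>y\<in>UNIV - {0}. x * y)"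
    by (simp add: prod.distrib)
  also have "\<dots> = \<Prod>(UNIV - {0})"
    by (rule prod.reindex_bij_witness[of _ "\<lambda>y. y / x" "\<lambda>y. x * y"]) (use assms in auto)
  finally show ?thesis by simp
qed

text \<open>Counting roots takes the place of a generator of the unit group. With n = q - 1 = g k,
  the polynomial y^n - 1 factors as (y^g - 1) S(y) and has n roots; S has at most n - g of them, so
  at least g are left for y^g - 1.\<close>

lemma card_roots_of_unity_dvd:
  assumes g: "g dvd CARD('a::{field,finite}) - 1"
  shows "card {y :: 'a. y ^ g = 1} = g"
proof -
  define n where "n = CARD('a) - 1"
  have n: "n > 0" using CARD_field_ge_2[where 'a = 'a] by (simp add: n_def)
  obtain k where k: "n = g * k" using g unfolding n_def by blast
  have gk: "g > 0" "k > 0" using n k by auto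
  define P where "P = monom (1 :: 'a) g - 1"
  define S where "S = (\<Sum>i<k. monom (1 :: 'a) (g * i))"
  have P: "poly P y = y ^ g - 1" for y by (simp add: P_def poly_monom)
  have S: "poly S y = (\<Sum>i<k. (y ^ g) ^ i)" for y
    by (simp add: S_def poly_sum poly_monom power_mult)
  \<comment> \<open>The values at 0 are -1 for \<open>P\<close> and 1 for \<open>S\<close>, so both
    are nonzero and the root bounds apply.\<close>
  have "poly P 0 \<noteq> 0" using gk by (simp add: P zero_power)
  then have "P \<noteq> 0" by auto
  have "poly S 0 = (\<Sum>i<k. if i = 0 then 1 else 0)"
    unfolding S using gk by (intro sum.cong) (auto simp: zero_power)
  then have "poly S 0 = 1" using gk by simp
  then have "S \<noteq> 0" by auto
  have degP: "degree P \<le> g" unfolding P_def by (intro degree_diff_le) (auto simp: degree_monom_le)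
  have degS: "degree S \<le> g * (k - 1)"
    unfolding S_def
  proof (rule degree_sum_le)
    fix i assume "i \<in> {..<k}"
    then have "g * i \<le> g * (k - 1)" by (intro mult_le_mono2) auto
    then show "degree (monom (1 :: 'a) (g * i)) \<le> g * (k - 1)"
      using degree_monom_le order_trans by blast
  qed simp
  have cardP: "card {y. poly P y = 0} \<le> g" using card_poly_roots_bound[OF \<open>P \<noteq> 0\<close>] degP by linarith
  have cardS: "card {y. poly S y = 0} \<le> g * (k - 1)" using card_poly_roots_bound[OF \<open>S \<noteq> 0\<close>] degS by linarith
  have "UNIV - {0} \<subseteq> {y. poly P y = 0} \<union> {y. poly S y = 0}"
  proof
    fix y :: 'a assume "y \<in> UNIV - {0}"
    then have "(y ^ g) ^ k = 1" using power_card_minus_1[of y] k by (simp add: n_def power_mult)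
    then have "poly P y * poly S y = 0" unfolding P S using power_diff_1_eq[of "y ^ g" k] by simp
    then show "y \<in> {y. poly P y = 0} \<union> {y. poly S y = 0}" by simp
  qed
  then have "card (UNIV - {0 :: 'a}) \<le> card ({y. poly P y = 0} \<union> {y. poly S y = 0})"
    by (intro card_mono) auto
  also have "\<dots> \<le> card {y. poly P y = 0} + card {y. poly S y = 0}" by (rule card_Un_le)
  finally have "n \<le> card {y. poly P y = 0} + g * (k - 1)" using cardS by (simp add: n_def card_Diff_subset)
  moreover have "n = g + g * (k - 1)" using gk by (cases k) (auto simp: k)
  ultimately have "card {y. poly P y = 0} = g" using cardP by linarith
  then show ?thesis by (simp add: P)
qed

text \<open>By Bezout, g is a combination of m and q - 1, and (q - 1)-th powers of nonzero elements
  are 1. So the m-th and the g-th roots of unity coincide.\<close>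

lemma card_roots_of_unity:
  assumes m: "m > 0"
  shows "card {y :: 'a::{field,finite}. y ^ m = 1} = gcd m (CARD('a) - 1)"
proof -
  define n where "n = CARD('a) - 1"
  define g where "g = gcd m n"
  have "y ^ m = 1 \<longleftrightarrow> y ^ g = 1" for y :: 'a
  proof
    assume y: "y ^ m = 1"
    then have y0: "y \<noteq> 0" using m by (auto simp: zero_power)
    obtain u v where uv: "m * u = n * v + g" using bezout_nat[of m n] m unfolding g_def by auto
    have "1 = y ^ (m * u)" using y by (simp add: power_mult)
    also have "\<dots> = y ^ g" using power_card_minus_1[OF y0] by (simp add: uv power_add power_mult n_def)
    finally show "y ^ g = 1" by simp
  next
    assume y: "y ^ g = 1"
    obtain k where "m = g * k" unfolding g_def by (metis dvdE gcd_dvd1)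
    then show "y ^ m = 1" using y by (simp add: power_mult)
  qed
  then have "card {y :: 'a. y ^ m = 1} = card {y :: 'a. y ^ g = 1}" by simp
  also have "\<dots> = g" by (rule card_roots_of_unity_dvd) (simp add: g_def n_def)
  finally show ?thesis by (simp add: g_def n_def)
qed

lemma root_count_0: "m > 0 \<Longrightarrow> root_count m (0 :: 'a::field) = 1"
  by (simp add: root_count_def)

text \<open>Multiplication by one m-th root of \<open>v\<close> carries the m-th roots of unity onto
  all m-th roots of \<open>v\<close>.\<close>

lemma root_count_nonzero:
  fixes v :: "'a::{field,finite}"
  assumes m: "m > 0" and v: "v \<noteq> 0"
  shows "root_count m v = 0 \<or> root_count m v = gcd m (CARD('a) - 1)"
proof (cases "\<exists>z. z ^ m = v")
  case True
  then obtain z where z: "z ^ m = v" by blast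
  then have z0: "z \<noteq> 0" using v m by (auto simp: zero_power)
  have "bij_betw (\<lambda>y. z * y) {y. y ^ m = 1} {y. y ^ m = v}"
  proof (rule bij_betw_byWitness[of _ "\<lambda>y. y / z"])
    show "(\<lambda>y. z * y) ` {y. y ^ m = 1} \<subseteq> {y. y ^ m = v}" using z by (auto simp: power_mult_distrib)
    show "(\<lambda>y. y / z) ` {y. y ^ m = v} \<subseteq> {y. y ^ m = 1}" using z v by (auto simp: power_divide)
  qed (use z0 in auto)
  then have "root_count m v = card {y :: 'a. y ^ m = 1}"
    unfolding root_count_def by (simp add: bij_betw_same_card)
  then show ?thesis using m by (simp add: card_roots_of_unity)
next
  case False
  then have "{y. y ^ m = v} = {}" by auto
  then show ?thesis by (simp add: root_count_def)
qed

text \<open>The fibres of the m-th power map partition the nonzero elements, and every nonempty one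
  has g elements.\<close>

lemma card_powers:
  assumes m: "m > 0"
  shows "gcd m (CARD('a::{field,finite}) - 1) * card {v :: 'a. v \<noteq> 0 \<and> root_count m v = gcd m (CARD('a) - 1)}
    = CARD('a) - 1"
proof -
  define g where "g = gcd m (CARD('a) - 1)"
  have "CARD('a) - 1 = card (\<Union>v\<in>- {0 :: 'a}. {y. y ^ m = v})"
  proof -
    have "(\<Union>v\<in>- {0 :: 'a}. {y. y ^ m = v}) = UNIV - {0}" using m by auto
    then show ?thesis by (simp add: card_Diff_subset)
  qed
  also have "\<dots> = (\<Sum>v\<in>- {0 :: 'a}. root_count m v)"
    unfolding root_count_def by (rule card_UN_disjoint) auto
  also have "\<dots> = (\<Sum>v\<in>- {0 :: 'a}. if root_count m v = g then g else 0)"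
    using root_count_nonzero[OF m] by (intro sum.cong) (auto simp: g_def)
  also have "\<dots> = g * card {v :: 'a. v \<noteq> 0 \<and> root_count m v = g}"
    by (simp add: sum.If_cases Int_def mult.commute)
  finally show ?thesis by (simp add: g_def)
qed

text \<open>The limiting law of f(x) at a single point: zero has weight (q - 1) w against weight 1
  for each nonzero value, normalized by the total (q - 1) (1 + w).\<close>

definition value_law :: "nat \<Rightarrow> 'a::{field,finite} \<Rightarrow> real" where
  "value_law N t =
    (let w = 1 / real CARD('a) + 1 / real CARD('a) ^ N + 1 / real CARD('a) ^ (N + 1)
     in (if t = 0 then w else 1 / real (CARD('a) - 1)) / (1 + w))"

text \<open>The law of the X_i is the image of \<open>value_law\<close> under the number of m-th
  roots. Treating the value 0 apart from the nonzero values reproduces the convention for g = 1,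
  where both land on 1 and their weights add.\<close>

lemma fibre_law_eq:
  assumes m: "m > 0"
  shows "fibre_law CARD('a::{field,finite}) m N u =
    (\<Sum>t\<in>{t :: 'a. root_count m t = u}. value_law N t)"
proof -
  define q where "q = real (CARD('a) - 1)"
  have q: "q > 0" using CARD_field_ge_2[where 'a = 'a] by (simp add: q_def)
  define g where "g = gcd m (CARD('a) - 1)"
  have g: "g > 0" using m by (simp add: g_def)
  define w where "w = 1 / real CARD('a) + 1 / real CARD('a) ^ N + 1 / real CARD('a) ^ (N + 1)"
  have w: "1 + w > 0" by (simp add: w_def add_pos_nonneg)
  define c where "c = card {v :: 'a. v \<noteq> 0 \<and> root_count m v = g}"
  have c: "real g * real c = q"
    using card_powers[OF m, where 'a = 'a] unfolding c_def g_def q_def by (metis of_nat_mult)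
  have "card {t :: 'a. t \<noteq> 0 \<and> root_count m t = 0} + c = CARD('a) - 1"
  proof -
    have "card (UNIV - {0 :: 'a}) = card ({t :: 'a. t \<noteq> 0 \<and> root_count m t = 0} \<union> {v. v \<noteq> 0 \<and> root_count m v = g})"
      using root_count_nonzero[OF m] by (intro arg_cong[of _ _ card]) (auto simp: g_def)
    also have "\<dots> = card {t :: 'a. t \<noteq> 0 \<and> root_count m t = 0} + c"
      unfolding c_def using g by (intro card_Un_disjoint) auto
    finally show ?thesis by (simp add: card_Diff_subset)
  qed
  then have c0: "real (card {t :: 'a. t \<noteq> 0 \<and> root_count m t = 0}) = q - real c"
    unfolding q_def by linarith
  \<comment> \<open>Among the nonzero values, a fraction 1/g are m-th powers, with g roots each, and
    the others have none; g > 0 keeps the two cases apart.\<close>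
  have count: "real (card {t :: 'a. t \<noteq> 0 \<and> root_count m t = u}) / q =
      (if u = 0 then 1 - 1 / real g else 0) + (if u = g then 1 / real g else 0)"
  proof -
    have cq: "real c / q = 1 / real g" using c q g by (simp add: field_simps)
    consider "u = 0" | "u = g" | "u \<noteq> 0" "u \<noteq> g" by blast
    then show ?thesis
    proof cases
      case 1
      then show ?thesis using c0 cq g q by (simp add: diff_divide_distrib)
    next
      case 2
      then show ?thesis using cq g by (simp add: c_def)
    next
      case 3
      then have "\<not> (t \<noteq> 0 \<and> root_count m t = u)" for t :: 'a
        using root_count_nonzero[OF m, of t] by (auto simp: g_def)
      then have "{t :: 'a. t \<noteq> 0 \<and> root_count m t = u} = {}" by blast
      then show ?thesis using 3 by simp
    qed
  qed
  have split: "{t :: 'a. root_count m t = u} =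
      {t. t = 0 \<and> root_count m t = u} \<union> {t. t \<noteq> 0 \<and> root_count m t = u}" by auto
  have "(\<Sum>t\<in>{t :: 'a. root_count m t = u}. value_law N t) =
      (\<Sum>t\<in>{t :: 'a. t = 0 \<and> root_count m t = u}. value_law N t) +
      (\<Sum>t\<in>{t :: 'a. t \<noteq> 0 \<and> root_count m t = u}. value_law N t)"
    unfolding split by (rule sum.union_disjoint) auto
  also have "(\<Sum>t\<in>{t :: 'a. t = 0 \<and> root_count m t = u}. value_law N t) = (if u = 1 then w / (1 + w) else 0)"
  proof -
    have "{t :: 'a. t = 0 \<and> root_count m t = u} = (if u = 1 then {0} else {})"
      using root_count_0[OF m, where 'a = 'a] by auto
    then show ?thesis by (simp add: value_law_def w_def Let_def)
  qed
  also have "(\<Sum>t\<in>{t :: 'a. t \<noteq> 0 \<and> root_count m t = u}. value_law N t) =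
      real (card {t :: 'a. t \<noteq> 0 \<and> root_count m t = u}) / q * (1 / (1 + w))"
  proof -
    have "value_law N t = 1 / q / (1 + w)" if "t \<noteq> 0" for t :: 'a
      unfolding value_law_def Let_def w_def[symmetric] q_def[symmetric] using that by simp
    then show ?thesis by simp
  qed
  also have "\<dots> = (if u = 0 then (1 - 1 / real g) * (1 / (1 + w)) else 0) +
      (if u = g then (1 / real g) * (1 / (1 + w)) else 0)"
    unfolding count by (simp add: distrib_right)
  finally show ?thesis
    unfolding fibre_law_def Let_def g_def[symmetric] w_def[symmetric] by simp
qed

section \<open>Sums of independent variables and the limiting ratio\<close>

lemma prod_sum_UNIV:
  fixes f :: "'b::finite \<Rightarrow> 'c::finite \<Rightarrow> real"
  shows "(\<Prod>x\<in>UNIV. \<Sum>t\<in>UNIV. f x t) = (\<Sum>a\<in>UNIV. \<Prod>x\<in>UNIV. f x (a x))"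
  using prod_sum_PiE[of UNIV "\<lambda>_. UNIV" f] by simp

text \<open>The event splits into disjoint events that prescribe every variable; independence makes
  each probability a product. The bijection \<open>e\<close> relabels the index set by a finite
  type, so that tuples become functions on the field.\<close>

lemma (in prob_space) prob_sum_indep_nat:
  fixes X :: "nat \<Rightarrow> 'a \<Rightarrow> nat" and e :: "nat \<Rightarrow> 'c::finite" and p :: "nat \<Rightarrow> real"
  assumes ind: "indep_vars (\<lambda>_. count_space UNIV) X I"
    and e: "bij_betw e I UNIV" and fin: "finite I" "I \<noteq> {}"
    and law: "\<And>i v. i \<in> I \<Longrightarrow> prob {\<omega> \<in> space M. X i \<omega> = v} = p v"
  shows "prob {\<omega> \<in> space M. (\<Sum>i\<in>I. X i \<omega>) = k} =
    (\<Sum>v\<in>{v :: 'c \<Rightarrow> nat. (\<Sum>x\<in>UNIV. v x) = k}. \<Prod>x\<in>UNIV. p (v x))"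
proof -
  define V where "V = {v :: 'c \<Rightarrow> nat. (\<Sum>x\<in>UNIV. v x) = k}"
  \<comment> \<open>A prescribed sum of natural numbers bounds every coordinate, so only finitely
    many tuples occur.\<close>
  have "V \<subseteq> (\<Pi>\<^sub>E x\<in>UNIV. {..k})"
  proof
    fix v assume "v \<in> V"
    then have "v x \<le> k" for x using member_le_sum[of x UNIV v] by (auto simp: V_def)
    then show "v \<in> (\<Pi>\<^sub>E x\<in>UNIV. {..k})" by auto
  qed
  then have finV: "finite V" by (rule finite_subset) (auto intro: finite_PiE)
  have meas: "X i -` A \<inter> space M \<in> events" if "i \<in> I" for i A
    using ind that unfolding indep_vars_def by (auto intro: measurable_sets)
  define Ev where "Ev v = (\<Inter>i\<in>I. X i -` {v (e i)} \<inter> space M)" for v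
  have Ev_meas: "Ev v \<in> events" for v
    unfolding Ev_def using fin meas by (intro sets.finite_INT) auto
  have Ev_iff: "\<omega> \<in> Ev v \<longleftrightarrow> \<omega> \<in> space M \<and> (\<forall>i\<in>I. X i \<omega> = v (e i))" for \<omega> v
    using fin(2) by (auto simp: Ev_def)
  have "{\<omega> \<in> space M. (\<Sum>i\<in>I. X i \<omega>) = k} = (\<Union>v\<in>V. Ev v)"
  proof (intro set_eqI iffI)
    fix \<omega> assume \<omega>: "\<omega> \<in> {\<omega> \<in> space M. (\<Sum>i\<in>I. X i \<omega>) = k}"
    define v where "v x = X (inv_into I e x) \<omega>" for x
    have ve: "v (e i) = X i \<omega>" if "i \<in> I" for i
      using e that by (simp add: v_def bij_betw_def inv_into_f_f)
    have "(\<Sum>x\<in>UNIV. v x) = (\<Sum>i\<in>I. v (e i))" by (rule sum.reindex_bij_betw[OF e, symmetric])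
    also have "\<dots> = k" using \<omega> ve by simp
    finally have "v \<in> V" by (simp add: V_def)
    moreover have "\<omega> \<in> Ev v" using \<omega> ve by (simp add: Ev_iff)
    ultimately show "\<omega> \<in> (\<Union>v\<in>V. Ev v)" by blast
  next
    fix \<omega> assume "\<omega> \<in> (\<Union>v\<in>V. Ev v)"
    then obtain v where v: "v \<in> V" "\<omega> \<in> Ev v" by blast
    have "(\<Sum>i\<in>I. X i \<omega>) = (\<Sum>i\<in>I. v (e i))" using v(2) by (intro sum.cong) (auto simp: Ev_iff)
    also have "\<dots> = (\<Sum>x\<in>UNIV. v x)" by (rule sum.reindex_bij_betw[OF e])
    finally show "\<omega> \<in> {\<omega> \<in> space M. (\<Sum>i\<in>I. X i \<omega>) = k}" using v by (simp add: V_def Ev_iff)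
  qed
  moreover have "disjoint_family_on Ev V"
    unfolding disjoint_family_on_def
  proof (intro ballI impI)
    fix v v' assume vv: "v \<in> V" "v' \<in> V" "v \<noteq> v'"
    then obtain x where x: "v x \<noteq> v' x" by auto
    have "x \<in> e ` I" using e by (simp add: bij_betw_def)
    then show "Ev v \<inter> Ev v' = {}" using x by (auto simp: Ev_iff)
  qed
  ultimately have "prob {\<omega> \<in> space M. (\<Sum>i\<in>I. X i \<omega>) = k} = (\<Sum>v\<in>V. prob (Ev v))"
    using finV Ev_meas by (simp add: finite_measure_finite_Union image_subset_iff)
  also have "\<dots> = (\<Sum>v\<in>V. \<Prod>x\<in>UNIV. p (v x))"
  proof (rule sum.cong[OF refl])
    fix v
    have "prob (Ev v) = (\<Prod>i\<in>I. prob (X i -` {v (e i)} \<inter> space M))"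
      unfolding Ev_def using ind fin by (intro indep_varsD_finite) auto
    also have "\<dots> = (\<Prod>i\<in>I. p (v (e i)))"
    proof (rule prod.cong[OF refl])
      fix i assume "i \<in> I"
      have "X i -` {v (e i)} \<inter> space M = {\<omega> \<in> space M. X i \<omega> = v (e i)}" by auto
      then show "prob (X i -` {v (e i)} \<inter> space M) = p (v (e i))" using law[OF \<open>i \<in> I\<close>] by simp
    qed
    also have "\<dots> = (\<Prod>x\<in>UNIV. p (v x))" by (rule prod.reindex_bij_betw[OF e])
    finally show "prob (Ev v) = (\<Prod>x\<in>UNIV. p (v x))" .
  qed
  finally show ?thesis by (simp add: V_def)
qed

text \<open>Expanding the product for a fixed \<open>v\<close> gives the functions \<open>a\<close>
  with \<open>r (a x) = v x\<close> at every x; running over all \<open>v\<close> groups the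
  functions \<open>a\<close> by their image.\<close>

lemma sum_prod_pushforward:
  fixes \<rho> :: "'b::finite \<Rightarrow> real" and r :: "'b \<Rightarrow> nat"
  shows "(\<Sum>v\<in>{v :: 'c::finite \<Rightarrow> nat. (\<Sum>x\<in>UNIV. v x) = k}. \<Prod>x\<in>UNIV. \<Sum>t\<in>{t. r t = v x}. \<rho> t) =
    (\<Sum>a\<in>{a :: 'c \<Rightarrow> 'b. (\<Sum>x\<in>UNIV. r (a x)) = k}. \<Prod>x\<in>UNIV. \<rho> (a x))"
proof -
  let ?V = "{v :: 'c \<Rightarrow> nat. (\<Sum>x\<in>UNIV. v x) = k}" and ?A = "{a :: 'c \<Rightarrow> 'b. (\<Sum>x\<in>UNIV. r (a x)) = k}"
  have "?V \<subseteq> (\<Pi>\<^sub>E x\<in>UNIV. {..k})"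
  proof
    fix v assume "v \<in> ?V"
    then have "v x \<le> k" for x using member_le_sum[of x UNIV v] by auto
    then show "v \<in> (\<Pi>\<^sub>E x\<in>UNIV. {..k})" by auto
  qed
  then have finV: "finite ?V" by (rule finite_subset) (auto intro: finite_PiE)
  have "(\<Sum>v\<in>?V. \<Prod>x\<in>UNIV. \<Sum>t\<in>{t. r t = v x}. \<rho> t) =
      (\<Sum>v\<in>?V. \<Sum>a\<in>{a \<in> ?A. (\<lambda>x. r (a x)) = v}. \<Prod>x\<in>UNIV. \<rho> (a x))"
  proof (rule sum.cong[OF refl])
    fix v assume "v \<in> ?V"
    then have "{a \<in> ?A. (\<lambda>x. r (a x)) = v} = {a. (\<lambda>x. r (a x)) = v}" by auto
    also have "\<dots> = (\<Pi>\<^sub>E x\<in>UNIV. {t. r t = v x})"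
      by (simp add: set_eq_iff fun_eq_iff PiE_iff)
    finally have "{a \<in> ?A. (\<lambda>x. r (a x)) = v} = (\<Pi>\<^sub>E x\<in>UNIV. {t. r t = v x})" .
    then show "(\<Prod>x\<in>UNIV. \<Sum>t\<in>{t. r t = v x}. \<rho> t) =
        (\<Sum>a\<in>{a \<in> ?A. (\<lambda>x. r (a x)) = v}. \<Prod>x\<in>UNIV. \<rho> (a x))"
      by (simp add: prod_sum_PiE)
  qed
  also have "\<dots> = (\<Sum>a\<in>?A. \<Prod>x\<in>UNIV. \<rho> (a x))"
    by (rule sum.group) (use finV in auto)
  finally show ?thesis .
qed

text \<open>The set \<open>C\<close> of leading coefficients lets one argument serve both families.
  With leading coefficient \<open>c\<close>, the monic part must take the values
  \<open>a x / c\<close>.\<close>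

lemma card_scaled_pairs_values:
  fixes a :: "'a::{field,finite} \<Rightarrow> 'a"
  assumes N: "N > 0" and C: "C \<subseteq> - {0}"
  shows "card {f \<in> (\<lambda>(c, s, d). smult c (s * d\<^sup>2)) ` (C \<times> squarefree_pairs N n). poly f = a} =
    (\<Sum>c\<in>C. card {(s, d) \<in> squarefree_pairs N n. \<forall>x. poly s x * (poly d x)\<^sup>2 = a x / c})"
proof -
  let ?f = "\<lambda>(c, s, d). smult c (s * (d :: 'a poly)\<^sup>2)"
  let ?T = "SIGMA c:C. {(s, d) \<in> squarefree_pairs N n. \<forall>x. poly s x * (poly d x)\<^sup>2 = a x / c}"
  have eq: "{f \<in> ?f ` (C \<times> squarefree_pairs N n). poly f = a} = ?f ` ?T"
  proof (intro set_eqI iffI)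
    fix f assume "f \<in> {f \<in> ?f ` (C \<times> squarefree_pairs N n). poly f = a}"
    then obtain c s d where *: "c \<in> C" "(s, d) \<in> squarefree_pairs N n" "f = smult c (s * d\<^sup>2)" "poly f = a" by auto
    have "c \<noteq> 0" using * C by auto
    then have "poly s x * (poly d x)\<^sup>2 = a x / c" for x
      unfolding *(4)[symmetric] *(3) by simp
    then show "f \<in> ?f ` ?T" using * by (intro image_eqI[of _ _ "(c, s, d)"]) auto
  next
    fix f assume "f \<in> ?f ` ?T"
    then obtain c s d where *: "c \<in> C" "(s, d) \<in> squarefree_pairs N n"
      "\<And>x. poly s x * (poly d x)\<^sup>2 = a x / c" "f = smult c (s * d\<^sup>2)" by auto
    have "c \<noteq> 0" using * C by auto
    then have "poly f = a" unfolding *(4) by (auto simp: *(3))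
    moreover have "f \<in> ?f ` (C \<times> squarefree_pairs N n)"
      using * by (intro image_eqI[of _ _ "(c, s, d)"]) auto
    ultimately show "f \<in> {f \<in> ?f ` (C \<times> squarefree_pairs N n). poly f = a}" by simp
  qed
  have "inj_on ?f ?T"
    by (rule inj_on_subset[OF inj_on_squarefree_pairs[of N n]]) (use C in auto)
  then have "card (?f ` ?T) = card ?T" by (rule card_image)
  also have "\<dots> = (\<Sum>c\<in>C. card {(s, d) \<in> squarefree_pairs N n. \<forall>x. poly s x * (poly d x)\<^sup>2 = a x / c})"
  proof (rule card_SigmaI, simp, intro ballI)
    show "finite {(s, d) \<in> squarefree_pairs N n. \<forall>x. poly s x * (poly d x)\<^sup>2 = a x / c}" for c
      by (rule finite_subset[OF _ finite_squarefree_pairs[OF N, of n]]) auto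
  qed
  finally show ?thesis unfolding eq .
qed

lemma card_poly_values_sum:
  fixes F :: "'a::{field,finite} poly set"
  assumes "finite F"
  shows "card {f \<in> F. P (poly f)} = (\<Sum>a\<in>{a. P a}. card {f \<in> F. poly f = a})"
proof -
  have "{f \<in> F. P (poly f)} = (\<Union>a\<in>{a. P a}. {f \<in> F. poly f = a})" by auto
  then show ?thesis using assms by (simp only:) (rule card_UN_disjoint, auto)
qed

text \<open>Numerator and denominator are both sums, over value functions, of counts asymptotic to
  K' q^n times a product over points. In the quotient K' q^n cancels and normalizing the product
  point by point gives \<open>value_law\<close>.\<close>

lemma curve_points_ratio_limit:
  fixes C :: "'a::{field,finite} set"
  assumes m: "m > 0" and N: "N \<ge> 2" and C: "C \<subseteq> - {0}" "C \<noteq> {}"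
  defines "F \<equiv> \<lambda>n. (\<lambda>(c, s, d). smult c (s * d\<^sup>2)) ` (C \<times> squarefree_pairs N n)"
  shows "(\<lambda>n. real (card {f \<in> F n. card (curve_points m f) = k}) / real (card (F n))) \<longlonglongrightarrow>
    (\<Sum>a\<in>{a :: 'a \<Rightarrow> 'a. (\<Sum>x\<in>UNIV. root_count m (a x)) = k}. \<Prod>x\<in>UNIV. value_law N (a x))"
proof -
  define q where "q = real CARD('a)"
  have q: "q \<ge> 2" using CARD_field_ge_2[where 'a = 'a] by (simp add: q_def)
  have q1: "real (CARD('a) - 1) = q - 1" using q by (simp add: q_def of_nat_diff)
  define w where "w = 1 / q + 1 / q ^ N + 1 / q ^ (N + 1)"
  have w: "w > 0" unfolding w_def using q by (intro add_pos_pos) auto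
  define \<alpha> where "\<alpha> = (q - 1) * w"
  define h where "h a = \<alpha> ^ card {x. a x = 0}" for a :: "'a \<Rightarrow> 'a"
  have h: "h a = (\<Prod>x\<in>UNIV. if a x = 0 then \<alpha> else 1)" for a
    unfolding h_def by (simp add: prod.If_cases)
  have finF: "finite (F n)" for n
    unfolding F_def using N by (intro finite_imageI finite_cartesian_product finite_squarefree_pairs) auto
  obtain K where K: "K > 0" and lim: "\<And>a :: 'a \<Rightarrow> 'a.
      (\<lambda>n. real (card {(s, d) \<in> squarefree_pairs N n. \<forall>x. poly s x * (poly d x)\<^sup>2 = a x}) / q ^ n)
        \<longlonglongrightarrow> K * h a"
    using squarefree_pairs_values_limit[OF N, where 'a = 'a]
    unfolding q_def[symmetric] q1 w_def[symmetric] \<alpha>_def[symmetric] h_def[symmetric] by blast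
  define K' where "K' = real (card C) * K"
  have K': "K' > 0" using K C by (simp add: K'_def card_gt_0_iff)
  have limF: "(\<lambda>n. real (card {f \<in> F n. poly f = a}) / q ^ n) \<longlonglongrightarrow> K' * h a" for a
  proof -
    have "(\<lambda>n. \<Sum>c\<in>C. real (card {(s, d) \<in> squarefree_pairs N n.
        \<forall>x. poly s x * (poly d x)\<^sup>2 = a x / c}) / q ^ n) \<longlonglongrightarrow> (\<Sum>c\<in>C. K * h (\<lambda>x. a x / c))"
      by (intro tendsto_sum lim)
    \<comment> \<open>The limit depends on \<open>a\<close> only through its zeros, which division
      by \<open>c\<close> preserves.\<close>
    also have "(\<Sum>c\<in>C. K * h (\<lambda>x. a x / c)) = (\<Sum>c\<in>C. K * h a)"
    proof (rule sum.cong[OF refl])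
      fix c assume "c \<in> C"
      then have "c \<noteq> 0" using C by auto
      then show "K * h (\<lambda>x. a x / c) = K * h a" by (simp add: h_def)
    qed
    also have "\<dots> = K' * h a" by (simp add: K'_def)
    finally show ?thesis
      unfolding F_def using N by (subst card_scaled_pairs_values[OF _ C(1)]) (simp_all add: sum_divide_distrib)
  qed
  have lim_sum: "(\<lambda>n. real (card {f \<in> F n. P (poly f)}) / q ^ n) \<longlonglongrightarrow> (\<Sum>a\<in>{a. P a}. K' * h a)" for P
    unfolding card_poly_values_sum[OF finF] of_nat_sum sum_divide_distrib by (intro tendsto_sum limF)
  \<comment> \<open>The sum of a product over points is the product of the sums at each point; this
    is where the normalizing factor (q - 1) (1 + w) per point comes from.\<close>
  define D where "D = (\<Sum>a\<in>(UNIV :: ('a \<Rightarrow> 'a) set). h a)"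
  have D: "D = ((q - 1) * (1 + w)) ^ CARD('a)"
  proof -
    have "(\<Sum>t\<in>(UNIV :: 'a set). if t = 0 then \<alpha> else 1) = \<alpha> + (q - 1)"
    proof -
      have "(\<Sum>t\<in>(UNIV :: 'a set). if t = 0 then \<alpha> else 1) = \<alpha> + (\<Sum>t\<in>UNIV - {0 :: 'a}. if t = 0 then \<alpha> else 1)"
        by (subst sum.remove[of UNIV 0]) auto
      also have "(\<Sum>t\<in>UNIV - {0 :: 'a}. if t = 0 then \<alpha> else 1) = (\<Sum>t\<in>UNIV - {0 :: 'a}. 1)"
        by (intro sum.cong) auto
      finally show ?thesis by (simp add: card_Diff_subset q1[symmetric])
    qed
    moreover have "D = (\<Prod>x\<in>(UNIV :: 'a set). \<Sum>t\<in>(UNIV :: 'a set). if t = 0 then \<alpha> else 1)"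
      unfolding D_def h by (rule prod_sum_UNIV[of "\<lambda>_ t. if t = 0 then \<alpha> else 1", symmetric])
    moreover have "\<alpha> + (q - 1) = (q - 1) * (1 + w)" by (simp add: \<alpha>_def algebra_simps)
    ultimately show ?thesis by simp
  qed
  have Dpos: "D > 0" unfolding D using q w by simp
  have D_lim: "(\<lambda>n. real (card (F n)) / q ^ n) \<longlonglongrightarrow> K' * D"
    using lim_sum[of "\<lambda>_. True"] by (simp add: D_def sum_distrib_left)
  let ?A = "{a :: 'a \<Rightarrow> 'a. (\<Sum>x\<in>UNIV. root_count m (a x)) = k}"
  have "(\<lambda>n. (real (card {f \<in> F n. card (curve_points m f) = k}) / q ^ n) / (real (card (F n)) / q ^ n))
      \<longlonglongrightarrow> (\<Sum>a\<in>?A. K' * h a) / (K' * D)"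
    unfolding card_curve_points using K' Dpos
    by (intro tendsto_divide D_lim lim_sum[of "\<lambda>a. (\<Sum>x\<in>UNIV. root_count m (a x)) = k"]) auto
  moreover have "(\<lambda>n. (real (card {f \<in> F n. card (curve_points m f) = k}) / q ^ n) / (real (card (F n)) / q ^ n)) =
      (\<lambda>n. real (card {f \<in> F n. card (curve_points m f) = k}) / real (card (F n)))"
    using q by (simp add: fun_eq_iff)
  moreover have "(\<Sum>a\<in>?A. K' * h a) / (K' * D) = (\<Sum>a\<in>?A. \<Prod>x\<in>UNIV. value_law N (a x))"
  proof -
    have law: "value_law N t = (if t = 0 then \<alpha> else 1) / ((q - 1) * (1 + w))" for t :: 'a
      unfolding value_law_def Let_def q1 q_def[symmetric] w_def[symmetric] \<alpha>_def using q by simp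
    have "(\<Prod>x\<in>UNIV. value_law N (a x)) = h a / D" for a :: "'a \<Rightarrow> 'a"
      unfolding law D h by (simp add: prod_dividef)
    then show ?thesis using K' by (simp add: sum_distrib_left[symmetric] sum_divide_distrib)
  qed
  ultimately show ?thesis by simp
qed

theorem theorem1p1:
  fixes m N k :: nat
    and M :: "'b measure"
    and X :: "nat \<Rightarrow> 'b \<Rightarrow> nat"
  assumes "m \<ge> 2" and "N \<ge> 2"
    and "prob_space M"
    and "prob_space.indep_vars M (\<lambda>_. count_space UNIV) X {1..CARD('a::{field,finite})}"
    and "\<And>i v. i \<in> {1..CARD('a)} \<Longrightarrow>
           measure M {\<omega> \<in> space M. X i \<omega> = v} = fibre_law CARD('a) m N v"
  shows
    "(\<lambda>d. real (card {f \<in> (F_monic d 4 [1, N, N + 1] :: 'a poly set). card (curve_points m f) = k})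
         / real (card (F_monic d 4 [1, N, N + 1] :: 'a poly set)))
       \<longlonglongrightarrow> measure M {\<omega> \<in> space M. (\<Sum>i=1..CARD('a). X i \<omega>) = k}
     \<and>
     (\<lambda>d. real (card {f \<in> (F_hat d 4 [1, N, N + 1] :: 'a poly set). card (curve_points m f) = k})
         / real (card (F_hat d 4 [1, N, N + 1] :: 'a poly set)))
       \<longlonglongrightarrow> measure M {\<omega> \<in> space M. (\<Sum>i=1..CARD('a). X i \<omega>) = k}"
proof -
  interpret prob_space M by fact
  have m: "m > 0" using assms(1) by simp
  obtain e where e: "bij_betw e {1..CARD('a)} (UNIV :: 'a set)"
    using ex_bij_betw_nat_finite_1[of "UNIV :: 'a set"] by auto
  have "prob {\<omega> \<in> space M. (\<Sum>i=1..CARD('a). X i \<omega>) = k} =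
      (\<Sum>v\<in>{v :: 'a \<Rightarrow> nat. (\<Sum>x\<in>UNIV. v x) = k}. \<Prod>x\<in>UNIV. fibre_law CARD('a) m N (v x))"
    by (rule prob_sum_indep_nat[OF assms(4) e _ _ assms(5)]) auto
  also have "\<dots> = (\<Sum>a\<in>{a :: 'a \<Rightarrow> 'a. (\<Sum>x\<in>UNIV. root_count m (a x)) = k}. \<Prod>x\<in>UNIV. value_law N (a x))"
    unfolding fibre_law_eq[OF m] by (rule sum_prod_pushforward)
  finally have law: "prob {\<omega> \<in> space M. (\<Sum>i=1..CARD('a). X i \<omega>) = k} = \<dots>" .
  \<comment> \<open>The monic family is the case \<open>C = {1}\<close> of the ratio limit, the full
    family the case of all nonzero leading coefficients.\<close>
  have monic: "F_monic d 4 [1, N, N + 1] =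
      (\<lambda>(c, s, d). smult c (s * d\<^sup>2)) ` ({1} \<times> (squarefree_pairs N d :: ('a poly \<times> 'a poly) set))" for d
  proof -
    have "{1 :: 'a} \<times> (squarefree_pairs N d :: ('a poly \<times> 'a poly) set) = Pair 1 ` squarefree_pairs N d" by auto
    then show ?thesis unfolding F_monic_eq by (simp only: image_image) (simp add: split_def)
  qed
  have "1 \<in> - {0 :: 'a}" by simp
  show ?thesis
    unfolding law
  proof
    show "(\<lambda>d. real (card {f \<in> (F_monic d 4 [1, N, N + 1] :: 'a poly set). card (curve_points m f) = k})
         / real (card (F_monic d 4 [1, N, N + 1] :: 'a poly set))) \<longlonglongrightarrow>
        (\<Sum>a\<in>{a :: 'a \<Rightarrow> 'a. (\<Sum>x\<in>UNIV. root_count m (a x)) = k}. \<Prod>x\<in>UNIV. value_law N (a x))"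
      unfolding monic by (rule curve_points_ratio_limit[OF m assms(2)]) auto
    show "(\<lambda>d. real (card {f \<in> (F_hat d 4 [1, N, N + 1] :: 'a poly set). card (curve_points m f) = k})
         / real (card (F_hat d 4 [1, N, N + 1] :: 'a poly set))) \<longlonglongrightarrow>
        (\<Sum>a\<in>{a :: 'a \<Rightarrow> 'a. (\<Sum>x\<in>UNIV. root_count m (a x)) = k}. \<Prod>x\<in>UNIV. value_law N (a x))"
      unfolding F_hat_eq by (rule curve_points_ratio_limit[OF m assms(2)]) (use \<open>1 \<in> - {0}\<close> in blast)+
  qed
qed

end
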